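(* For $n\ge1$ let $b(n)$ (resp. $b^*(n)$) be the number of alternating (resp. reverse alternating) permutations in $\mathfrak S_n$ that are $n$-cycles (i.e. of cycle type $(n)$). Then: (a) If $n$ is odd, $b(n)=b^*(n)=\frac1n\sum_{d\mid n}\mu(d)(-1)^{(d-1)/2}E_{n/d}$. (b) If $n=2^km$ with $k\ge1$, $m$ odd and $m\ge3$, then $b(n)=b^*(n)=\frac1n\sum_{d\mid m}\mu(d)E_{n/d}$. (c) If $n=2^k$ with $k\ge2$, then $b(n)=b^*(n)=\frac1n(E_n-1)$. (d) $b(2)=1$ and $b^*(2)=0$.
   Context: A permutation $a_1\cdots a_n$ is alternating if $a_1>a_2<a_3>\cdots$ and reverse alternating if $a_1<a_2>a_3<\cdots$. $\mu$ is the number-theoretic Möbius function. Euler numbers $E_n$: $\sum_{n\ge0}E_nx^n/n!=\sec x+\tan x$. *)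

theory Defs
  imports
    Complex_Main
    "HOL-Combinatorics.Permutations"
    "HOL-Combinatorics.Orbits"
    "HOL-Computational_Algebra.Computational_Algebra"
begin

definition euler_num :: "nat \<Rightarrow> real" where
  "euler_num n = fact n * fps_nth (inverse (fps_cos 1) + fps_tan 1) n"

lemma euler_num_egf:
  "Abs_fps (\<lambda>n. euler_num n / fact n) = inverse (fps_cos 1) + fps_tan 1"
  by (rule fps_ext) (simp add: euler_num_def)

definition moebius_mu :: "nat \<Rightarrow> int" where
  "moebius_mu n = (if squarefree n then (- 1) ^ card (prime_factors n) else 0)"

(* The word a_1 ... a_n is given by a_i = w i for 1 \<le> i \<le> n. *)

definition alternating :: "nat \<Rightarrow> (nat \<Rightarrow> nat) \<Rightarrow> bool" where
  "alternating n w \<longleftrightarrow> (\<forall>i\<in>{1..<n}. if odd i then w i > w (i + 1) else w i < w (i + 1))"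

definition reverse_alternating :: "nat \<Rightarrow> (nat \<Rightarrow> nat) \<Rightarrow> bool" where
  "reverse_alternating n w \<longleftrightarrow>
     (\<forall>i\<in>{1..<n}. if odd i then w i < w (i + 1) else w i > w (i + 1))"

(* For w permuting {1..n}, cyclic_on w {1..n} says that {1..n} is a single orbit of w,
   i.e. that w has cycle type (n); for n = 1 the identity qualifies. *)

definition alt_cycles :: "nat \<Rightarrow> nat" where
  "alt_cycles n = card {w. w permutes {1..n} \<and> cyclic_on w {1..n} \<and> alternating n w}"

definition rev_alt_cycles :: "nat \<Rightarrow> nat" where
  "rev_alt_cycles n =
     card {w. w permutes {1..n} \<and> cyclic_on w {1..n} \<and> reverse_alternating n w}"

end

theory Submission
  imports Defs "HOL-Combinatorics.Multiset_Permutations"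
begin

text \<open>
  Cut \<open>{1..n}\<close> after every element of \<open>T\<close> and read off the blocks visited by the iterates
  \<open>i, w i, w (w i), \<dots>\<close> of an \<open>n\<close>-cycle \<open>w\<close>. If all descents of \<open>w\<close> lie in \<open>T\<close>, then \<open>w\<close> is increasing on
  every block, so the order of the points is the lexicographic order of their itineraries. Hence the
  itinerary is a primitive circular word that determines \<open>(w, i)\<close>, and every primitive word whose letter
  multiplicities are the block sizes occurs (the Gessel-Reutenauer bijection for \<open>n\<close>-cycles).

  Counting primitive words by Moebius inversion and passing from ``descents in \<open>T\<close>'' to ``descent set
  \<open>S\<close>'' by inclusion-exclusion expresses \<open>n\<close> times the number of \<open>n\<close>-cycles with descent set \<open>S\<close> as
  a Moebius sum over \<open>d dvd n\<close> of alternating sums of multinomial coefficients for \<open>n div d\<close> and the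
  set \<open>{t. d * t \<in> S}\<close>. If \<open>S\<close> consists of the odd (even) numbers, this set is of the same kind for
  odd \<open>d\<close>, and is empty (everything) for even \<open>d\<close>. Removing the largest cut gives recurrences for the
  alternating sums, which are the identities between \<open>sec\<close>, \<open>tan\<close>, \<open>sin\<close> and \<open>cos\<close>.
\<close>

section \<open>Periodic words and the lexicographic order of their shifts\<close>

text \<open>Compares the shifts of one infinite word starting at positions \<open>p\<close> and
  \<open>q\<close>. Shifts are infinite, so neither is a proper prefix of the other, and the first
  difference decides.\<close>

definition lexless :: "(nat \<Rightarrow> nat) \<Rightarrow> nat \<Rightarrow> nat \<Rightarrow> bool" where
  "lexless x p q \<longleftrightarrow> (\<exists>k. (\<forall>l<k. x (p + l) = x (q + l)) \<and> x (p + k) < x (q + k))"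

lemma lexless_irrefl: "\<not> lexless x p p"
  by (auto simp: lexless_def)

lemma lexless_trans:
  assumes "lexless x p q" "lexless x q r"
  shows "lexless x p r"
proof -
  obtain k where k: "\<forall>l<k. x (p + l) = x (q + l)" "x (p + k) < x (q + k)"
    using assms(1) by (auto simp: lexless_def)
  obtain j where j: "\<forall>l<j. x (q + l) = x (r + l)" "x (q + j) < x (r + j)"
    using assms(2) by (auto simp: lexless_def)
  have "(\<forall>l<min k j. x (p + l) = x (r + l)) \<and> x (p + min k j) < x (r + min k j)"
    using k j by (cases k j rule: linorder_cases) (auto simp: min_def)
  then show ?thesis unfolding lexless_def by blast
qed

lemma lexless_total:
  assumes "x (p + l) \<noteq> x (q + l)"
  shows "lexless x p q \<or> lexless x q p"
proof -
  define k where "k = (LEAST l. x (p + l) \<noteq> x (q + l))"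
  have 1: "x (p + k) \<noteq> x (q + k)"
    unfolding k_def using assms by (rule LeastI)
  have "\<forall>l<k. x (p + l) = x (q + l)"
    unfolding k_def using not_less_Least by blast
  moreover have "x (p + k) < x (q + k) \<or> x (q + k) < x (p + k)" using 1 by linarith
  ultimately show ?thesis unfolding lexless_def by (metis (no_types))
qed

text \<open>Dropping a common first letter moves the first difference one place forward. This is
  what makes the map built in \<open>cycle_word_surj\<close> increasing on blocks.\<close>

lemma lexless_Suc:
  assumes "lexless x p q" "x p = x q"
  shows "lexless x (Suc p) (Suc q)"
proof -
  obtain k where k: "\<forall>l<k. x (p + l) = x (q + l)" "x (p + k) < x (q + k)"
    using assms(1) by (auto simp: lexless_def)
  with assms(2) obtain j where "k = Suc j" by (cases k) auto
  with k have "(\<forall>l<j. x (Suc p + l) = x (Suc q + l)) \<and> x (Suc p + j) < x (Suc q + j)"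
    by (metis Suc_less_eq add_Suc_shift)
  then show ?thesis unfolding lexless_def by blast
qed

text \<open>A circular word of length \<open>n\<close> with a marked starting point is encoded as an
  \<open>n\<close>-periodic function on all naturals, so that shifting needs no modular
  arithmetic.\<close>

definition periodic :: "nat \<Rightarrow> (nat \<Rightarrow> 'a) \<Rightarrow> bool" where
  "periodic n x \<longleftrightarrow> (\<forall>p. x (p + n) = x p)"

lemma periodic_add_mult: "periodic n x \<Longrightarrow> x (p + k * n) = x p"
proof (induction k)
  case (Suc k)
  then have "x ((p + k * n) + n) = x p" unfolding periodic_def by simp
  then show ?case by (simp add: algebra_simps)
qed simp

lemma periodic_mult: "periodic n x \<Longrightarrow> periodic (k * n) x"
  unfolding periodic_def[of "k * n"] by (intro allI periodic_add_mult)

lemma periodic_mod: "periodic n x \<Longrightarrow> x (p mod n) = x p"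
  using periodic_add_mult[of n x "p mod n" "p div n"] by simp

text \<open>By Bezout in the form \<open>a * u = b * v + gcd a b\<close>, a shift by the gcd
  followed by \<open>v\<close> periods \<open>b\<close> amounts to \<open>u\<close> periods
  \<open>a\<close>. All shifts go forward, as the words are one-sided.\<close>

lemma periodic_gcd:
  assumes "periodic a x" "periodic b x" "a > 0"
  shows "periodic (gcd a b) x"
proof -
  obtain u v where uv: "a * u = b * v + gcd a b"
    using bezout_nat[of a b] assms(3) by auto
  have "x (p + gcd a b) = x p" for p
  proof -
    have "x (p + gcd a b) = x (p + gcd a b + v * b)"
      using periodic_add_mult[OF assms(2)] by simp
    also have "p + gcd a b + v * b = p + u * a"
      using uv by (simp add: algebra_simps)
    also have "x \<dots> = x p" using periodic_add_mult[OF assms(1)] by simp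
    finally show ?thesis .
  qed
  then show ?thesis by (simp add: periodic_def)
qed

definition primitive :: "nat \<Rightarrow> (nat \<Rightarrow> 'a) \<Rightarrow> bool" where
  "primitive n x \<longleftrightarrow> periodic n x \<and> (\<forall>e. 0 < e \<and> e < n \<longrightarrow> \<not> periodic e x)"

lemma lexless_periodic:
  assumes "periodic n x"
  shows "lexless x q (p + n) \<longleftrightarrow> lexless x q p"
proof -
  have "x (p + n + l) = x (p + l)" for l
    using assms[unfolded periodic_def, rule_format, of "p + l"] by (simp add: ac_simps)
  then show ?thesis by (simp add: lexless_def)
qed

text \<open>If the shifts at \<open>p < q\<close> agreed everywhere, then \<open>q - p\<close> would
  be a period smaller than \<open>n\<close>.\<close>

lemma primitive_lexless_total:
  assumes x: "primitive n x" and "p < n" "q < n" "p \<noteq> q"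
  shows "lexless x p q \<or> lexless x q p"
proof -
  have main: "\<exists>l. x (p + l) \<noteq> x (q + l)" if "p < q" "q < n" for p q
  proof (rule ccontr)
    assume "\<not> ?thesis"
    then have eq: "x (p + l) = x (q + l)" for l by auto
    have per: "periodic n x" using x by (simp add: primitive_def)
    have "x (m + (q - p)) = x m" for m
    proof -
      \<comment> \<open>The assumed agreement concerns positions from \<open>p\<close> on. Adding
        \<open>p * n\<close>, a multiple of the period, brings any \<open>m\<close> into that
        range.\<close>
      have le: "p \<le> m + p * n" using that by (simp add: trans_le_add2)
      have "x m = x (m + p * n)" using periodic_add_mult[OF per] by simp
      also have "\<dots> = x (p + (m + p * n - p))" using le by simp
      also have "\<dots> = x (q + (m + p * n - p))" by (rule eq)
      also have "q + (m + p * n - p) = (m + (q - p)) + p * n" using le that by simp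
      also have "x \<dots> = x (m + (q - p))" using periodic_add_mult[OF per] by simp
      finally show ?thesis by simp
    qed
    then have "periodic (q - p) x" by (simp add: periodic_def)
    with x that show False by (auto simp: primitive_def)
  qed
  have "\<exists>l. x (p + l) \<noteq> x (q + l)"
  proof (cases "p < q")
    case True
    then show ?thesis using main[of p q] assms by simp
  next
    case False
    with assms obtain l where "x (q + l) \<noteq> x (p + l)" using main[of q p] by force
    then show ?thesis by (metis (no_types))
  qed
  then obtain l where "x (p + l) \<noteq> x (q + l)" ..
  then show ?thesis by (rule lexless_total)
qed

text \<open>The place, counted from 1, of the shift at \<open>p\<close> among the \<open>n\<close>
  shifts. It will turn out to be the point of \<open>{1..n}\<close> that the cycle visits at time
  \<open>p\<close>.\<close>

definition lexrank :: "nat \<Rightarrow> (nat \<Rightarrow> nat) \<Rightarrow> nat \<Rightarrow> nat" where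
  "lexrank n x p = Suc (card {q. q < n \<and> lexless x q p})"

lemma lexrank_less:
  assumes "lexless x p q" "p < n"
  shows "lexrank n x p < lexrank n x q"
proof -
  have "{r. r < n \<and> lexless x r p} \<subset> {r. r < n \<and> lexless x r q}"
    using assms lexless_trans[OF _ assms(1)] lexless_irrefl[of x p] by auto
  then show ?thesis unfolding lexrank_def by (simp add: psubset_card_mono)
qed

lemma lexrank_periodic: "periodic n x \<Longrightarrow> periodic n (lexrank n x)"
  unfolding periodic_def[of n "lexrank n x"] by (simp add: lexrank_def lexless_periodic)

lemma lexrank_bij:
  assumes "primitive n x"
  shows "bij_betw (lexrank n x) {..<n} {1..n}"
proof -
  have inj: "inj_on (lexrank n x) {..<n}"
  proof (rule inj_onI)
    fix p q assume "p \<in> {..<n}" "q \<in> {..<n}" "lexrank n x p = lexrank n x q"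
    then show "p = q"
      using primitive_lexless_total[OF assms, of p q] lexrank_less[of x p q n] lexrank_less[of x q p n]
      by auto
  qed
  have "lexrank n x p \<in> {1..n}" if "p < n" for p
  proof -
    have "{q. q < n \<and> lexless x q p} \<subset> {..<n}" using that lexless_irrefl by auto
    then have "card {q. q < n \<and> lexless x q p} < card {..<n}"
      by (intro psubset_card_mono) auto
    then show ?thesis by (simp add: lexrank_def)
  qed
  then have "lexrank n x ` {..<n} \<subseteq> {1..n}" by auto
  moreover have "card (lexrank n x ` {..<n}) = card {1..n}"
    using inj by (simp add: card_image)
  ultimately have "lexrank n x ` {..<n} = {1..n}" by (intro card_subset_eq) auto
  with inj show ?thesis by (simp add: bij_betw_def)
qed

lemma lexrank_less_iff:
  assumes "primitive n x" "p < n" "q < n"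
  shows "lexrank n x p < lexrank n x q \<longleftrightarrow> lexless x p q"
  using primitive_lexless_total[OF assms] lexrank_less[of x p q n] lexrank_less[of x q p n] assms
  by (cases "p = q") auto

section \<open>Cycles with prescribed descents and primitive words\<close>

text \<open>Blocks are numbered from 0. The strict comparison puts a cut \<open>t\<close> at the end
  of its block: the next block starts at \<open>Suc t\<close>.\<close>

definition block :: "nat set \<Rightarrow> nat \<Rightarrow> nat" where
  "block T i = card {t \<in> T. t < i}"

lemma block_mono: "finite T \<Longrightarrow> i \<le> j \<Longrightarrow> block T i \<le> block T j"
  unfolding block_def by (rule card_mono) auto

lemma block_less:
  assumes "finite T" "t \<in> T" "i \<le> t" "t < j"
  shows "block T i < block T j"
proof -
  have "t \<in> {t \<in> T. t < j}" "t \<notin> {t \<in> T. t < i}" using assms by auto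
  moreover have "{t \<in> T. t < i} \<subseteq> {t \<in> T. t < j}" using assms by auto
  ultimately have "{t \<in> T. t < i} \<subset> {t \<in> T. t < j}" by blast
  then show ?thesis unfolding block_def using assms by (intro psubset_card_mono) auto
qed

definition descents :: "nat \<Rightarrow> (nat \<Rightarrow> nat) \<Rightarrow> nat set" where
  "descents n w = {i \<in> {1..<n}. w i > w (Suc i)}"

text \<open>Two points share a block iff no cut lies between them, so ascents at all uncut positions
  chain up to monotonicity on blocks; conversely an uncut \<open>i\<close> shares its block with
  \<open>Suc i\<close>.\<close>

lemma descents_subset_iff:
  assumes "inj w" "finite T"
  shows "descents n w \<subseteq> T \<longleftrightarrow>
    (\<forall>i j. 1 \<le> i \<and> i < j \<and> j \<le> n \<and> block T i = block T j \<longrightarrow> w i < w j)"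
proof (intro iffI allI impI)
  fix i j assume D: "descents n w \<subseteq> T"
    and ij: "1 \<le> i \<and> i < j \<and> j \<le> n \<and> block T i = block T j"
  have step: "w l < w (Suc l)" if "i \<le> l" "l < j" for l
  proof -
    have "l \<notin> T" using block_less[OF assms(2), of l i j] that ij by auto
    then have "l \<notin> descents n w" using D by blast
    then have "\<not> w l > w (Suc l)" using that ij by (auto simp: descents_def)
    moreover have "w l \<noteq> w (Suc l)" using assms(1) by (metis injD n_not_Suc_n)
    ultimately show ?thesis by simp
  qed
  have "w i < w (Suc i + k)" if "Suc i + k \<le> j" for k
    using that
  proof (induction k)
    case 0
    then show ?case using step[of i] by simp
  next
    case (Suc k)
    then show ?case using step[of "Suc i + k"] by simp
  qed
  from this[of "j - Suc i"] ij show "w i < w j" by simp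
next
  assume *: "\<forall>i j. 1 \<le> i \<and> i < j \<and> j \<le> n \<and> block T i = block T j \<longrightarrow> w i < w j"
  show "descents n w \<subseteq> T"
  proof
    fix i assume i: "i \<in> descents n w"
    show "i \<in> T"
    proof (rule ccontr)
      assume "i \<notin> T"
      then have "{t \<in> T. t < Suc i} = {t \<in> T. t < i}" using less_Suc_eq by auto
      then have "block T i = block T (Suc i)" by (simp add: block_def)
      then have "w i < w (Suc i)" using *[rule_format, of i "Suc i"] i by (auto simp: descents_def)
      then show False using i by (auto simp: descents_def)
    qed
  qed
qed

definition block_content :: "nat \<Rightarrow> nat set \<Rightarrow> nat multiset" where
  "block_content n T = image_mset (block T) (mset_set {1..n})"

definition words :: "nat \<Rightarrow> nat set \<Rightarrow> (nat \<Rightarrow> nat) set" where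
  "words n T = {x. periodic n x \<and> image_mset x (mset_set {..<n}) = block_content n T}"

text \<open>Inclusion rather than equality, since monotonicity on the blocks is exactly what the
  bijection with words can express.\<close>

definition desc_cycles :: "nat \<Rightarrow> nat set \<Rightarrow> (nat \<Rightarrow> nat) set" where
  "desc_cycles n T = {w. w permutes {1..n} \<and> cyclic_on w {1..n} \<and> descents n w \<subseteq> T}"

section \<open>Itineraries of cycles whose descents lie in a given set\<close>

lemma cyclic_on_funpow_bij:
  assumes "cyclic_on w {1..n}" "i \<in> {1..n}"
  shows "bij_betw (\<lambda>p. (w ^^ p) i) {..<n} {1..n}" "(w ^^ n) i = i"
proof -
  define m where "m = funpow_dist1 w i i"
  have orb: "orbit w i = {1..n}" using orbit_cyclic_eq3[OF assms] .
  then have self: "i \<in> orbit w i" using assms by simp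
  have inj: "inj_on (\<lambda>p. (w ^^ p) i) {..<m}"
    using inj_on_funpow_dist1[OF self] by (simp only: m_def atLeast0LessThan)
  have im: "(\<lambda>p. (w ^^ p) i) ` {..<m} = {1..n}"
    using orbit_conv_funpow_dist1[OF self] orb by (simp only: m_def atLeast0LessThan)
  have "m = n" using card_image[OF inj] im by simp
  then show "bij_betw (\<lambda>p. (w ^^ p) i) {..<n} {1..n}" using inj im by (simp add: bij_betw_def)
  show "(w ^^ n) i = i"
    using funpow_dist1_prop[OF self] \<open>m = n\<close> by (simp only: m_def)
qed

text \<open>Induction on the length of the common prefix. At the first difference the blocks
  themselves order the points. Going one step back, two points in the same block are ordered like
  their images, because \<open>w\<close> is increasing there.\<close>

lemma cycle_word_order:
  assumes mono: "\<And>i j. 1 \<le> i \<Longrightarrow> i < j \<Longrightarrow> j \<le> n \<Longrightarrow> block T i = block T j \<Longrightarrow> w i < w j"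
    and T: "finite T" and w: "\<And>p. (w ^^ p) i \<in> {1..n}"
    and "lexless (\<lambda>p. block T ((w ^^ p) i)) p q"
  shows "(w ^^ p) i < (w ^^ q) i"
proof -
  have main: "(w ^^ p) i < (w ^^ q) i"
    if "\<forall>l<k. block T ((w ^^ (p + l)) i) = block T ((w ^^ (q + l)) i)"
      "block T ((w ^^ (p + k)) i) < block T ((w ^^ (q + k)) i)" for k p q
    using that
  proof (induction k arbitrary: p q)
    case 0
    then show ?case using block_mono[OF T, of "(w ^^ q) i" "(w ^^ p) i"]
      by (metis add_0_right leD leI)
  next
    case (Suc k)
    have "(w ^^ Suc p) i < (w ^^ Suc q) i"
    proof (rule Suc.IH)
      show "\<forall>l<k. block T ((w ^^ (Suc p + l)) i) = block T ((w ^^ (Suc q + l)) i)"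
        using Suc.prems(1) by (metis Suc_less_eq add_Suc_shift)
      show "block T ((w ^^ (Suc p + k)) i) < block T ((w ^^ (Suc q + k)) i)"
        using Suc.prems(2) by (metis add_Suc_shift)
    qed
    then have less: "w ((w ^^ p) i) < w ((w ^^ q) i)" by simp
    have eq: "block T ((w ^^ p) i) = block T ((w ^^ q) i)"
      using Suc.prems(1) by (metis add_0_right zero_less_Suc)
    show ?case
    proof (rule ccontr)
      assume "\<not> ?case"
      with less have "(w ^^ q) i < (w ^^ p) i" by (metis less_irrefl linorder_neqE_nat)
      then have "w ((w ^^ q) i) < w ((w ^^ p) i)"
        using mono[of "(w ^^ q) i" "(w ^^ p) i"] w eq by auto
      with less show False by simp
    qed
  qed
  obtain k where "\<forall>l<k. block T ((w ^^ (p + l)) i) = block T ((w ^^ (q + l)) i)"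
      "block T ((w ^^ (p + k)) i) < block T ((w ^^ (q + k)) i)"
    using assms(4) unfolding lexless_def by blast
  then show ?thesis by (rule main)
qed

text \<open>The starting point belongs to the argument: the \<open>n\<close> rotations of an
  itinerary count as different words, which produces the factor \<open>n\<close> in the
  count.\<close>

definition cycle_word :: "nat set \<Rightarrow> (nat \<Rightarrow> nat) \<times> nat \<Rightarrow> nat \<Rightarrow> nat" where
  "cycle_word T = (\<lambda>(w, i) p. block T ((w ^^ p) i))"

context
  fixes n :: nat and T :: "nat set" and w :: "nat \<Rightarrow> nat" and i :: nat
  assumes fin: "finite T" and w: "w \<in> desc_cycles n T" and i: "i \<in> {1..n}"
begin

lemma desc_cycles_block_mono:
  assumes "1 \<le> a" "a < b" "b \<le> n" "block T a = block T b"
  shows "w a < w b"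
proof -
  have "inj w" using w permutes_inj by (auto simp: desc_cycles_def)
  moreover have "descents n w \<subseteq> T" using w by (simp add: desc_cycles_def)
  ultimately show ?thesis
    using assms descents_subset_iff[of w T n] fin by blast
qed

lemma desc_cycles_funpow_in: "(w ^^ p) i \<in> {1..n}"
  using w i cyclic_on_funpow_in[of w "{1..n}" i p] by (simp add: desc_cycles_def)

lemma desc_cycles_bij: "bij_betw (\<lambda>p. (w ^^ p) i) {..<n} {1..n}" "(w ^^ n) i = i"
  using cyclic_on_funpow_bij[of w n i] w i by (simp_all add: desc_cycles_def)

lemma cycle_word_in_words: "cycle_word T (w, i) \<in> words n T"
proof -
  have "periodic n (cycle_word T (w, i))"
    using desc_cycles_bij(2) by (simp add: periodic_def cycle_word_def funpow_add)
  moreover have "image_mset (cycle_word T (w, i)) (mset_set {..<n}) = block_content n T"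
  proof -
    have "image_mset (cycle_word T (w, i)) (mset_set {..<n}) =
        image_mset (block T) (image_mset (\<lambda>p. (w ^^ p) i) (mset_set {..<n}))"
      by (simp add: cycle_word_def multiset.map_comp o_def)
    also have "image_mset (\<lambda>p. (w ^^ p) i) (mset_set {..<n}) = mset_set {1..n}"
      using desc_cycles_bij(1) by (simp add: image_mset_mset_set bij_betw_def)
    finally show ?thesis by (simp add: block_content_def)
  qed
  ultimately show ?thesis by (simp add: words_def)
qed

text \<open>A proper period \<open>e\<close> would make the iterates of \<open>w ^^ e\<close> on \<open>i\<close> strictly monotone,
  although they return to \<open>i\<close>.\<close>

lemma cycle_word_primitive: "primitive n (cycle_word T (w, i))"
proof -
  have "\<not> periodic e (cycle_word T (w, i))" if e: "0 < e" "e < n" for e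
  proof
    assume per: "periodic e (cycle_word T (w, i))"
    define s where "s k = (w ^^ (k * e)) i" for k
    have eq: "block T ((w ^^ (p + e)) i) = block T ((w ^^ p) i)" for p
      using per by (simp add: periodic_def cycle_word_def)
    have up: "(w ^^ p) i < (w ^^ (p + e)) i" if "i < (w ^^ e) i" for p
    proof (induction p)
      case (Suc p)
      have "w ((w ^^ p) i) < w ((w ^^ (p + e)) i)"
        using desc_cycles_block_mono[of "(w ^^ p) i" "(w ^^ (p + e)) i"] Suc eq[of p]
          desc_cycles_funpow_in[of p] desc_cycles_funpow_in[of "p + e"] by auto
      then show ?case by simp
    qed (use that in simp)
    have down: "(w ^^ (p + e)) i < (w ^^ p) i" if "(w ^^ e) i < i" for p
    proof (induction p)
      case (Suc p)
      have "w ((w ^^ (p + e)) i) < w ((w ^^ p) i)"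
        using desc_cycles_block_mono[of "(w ^^ (p + e)) i" "(w ^^ p) i"] Suc eq[of p]
          desc_cycles_funpow_in[of p] desc_cycles_funpow_in[of "p + e"] by auto
      then show ?case by simp
    qed (use that in simp)
    have "(w ^^ e) i \<noteq> (w ^^ 0) i"
      using bij_betw_imp_inj_on[OF desc_cycles_bij(1)] e by (auto dest!: inj_onD[of _ _ e 0])
    then consider "i < (w ^^ e) i" | "(w ^^ e) i < i" by fastforce
    moreover have s0: "s 0 = i" by (simp add: s_def)
    \<comment> \<open>Making \<open>n\<close> jumps of length \<open>e\<close> amounts to going
      \<open>e\<close> times around the whole cycle.\<close>
    have sn: "s n = i"
    proof -
      have "(w ^^ (k * n)) i = i" for k
        by (induction k) (simp_all add: funpow_add desc_cycles_bij(2))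
      from this[of e] show ?thesis by (simp add: s_def mult.commute)
    qed
    ultimately show False
    proof cases
      case 1
      then have "s k < s (Suc k)" for k using up[of "k * e"] by (simp add: s_def add.commute)
      then have "s 0 < s n" using lift_Suc_mono_less[of s 0 n] e by simp
      then show False using s0 sn by simp
    next
      case 2
      then have dec: "s (Suc k) < s k" for k using down[of "k * e"] by (simp add: s_def add.commute)
      have "s (Suc k) < s 0" for k
        by (induction k) (use dec less_trans in blast)+
      from this[of "n - 1"] show False using s0 sn e by simp
    qed
  qed
  then show ?thesis using cycle_word_in_words by (simp add: primitive_def words_def)
qed

text \<open>The orbit fills \<open>{1..n}\<close>, so a point is one more than the number of visited
  points below it, and these correspond to the lexicographically smaller shifts. Hence the itinerary
  alone recovers the orbit.\<close>

lemma funpow_eq_lexrank: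
  assumes "p < n"
  shows "(w ^^ p) i = lexrank n (cycle_word T (w, i)) p"
proof -
  let ?x = "cycle_word T (w, i)"
  have less: "(w ^^ p) i < (w ^^ q) i" if "lexless ?x p q" for p q
  proof (rule cycle_word_order[of n T w i])
    show "lexless (\<lambda>p. block T ((w ^^ p) i)) p q"
      using that unfolding cycle_word_def prod.case .
  qed (use fin desc_cycles_block_mono desc_cycles_funpow_in in blast)+
  have iff: "lexless ?x q p \<longleftrightarrow> (w ^^ q) i < (w ^^ p) i" if "q < n" for q
  proof
    assume "(w ^^ q) i < (w ^^ p) i"
    then have "q \<noteq> p" "\<not> lexless ?x p q" using less[of p q] by auto
    then show "lexless ?x q p"
      using primitive_lexless_total[OF cycle_word_primitive that assms] by simp
  qed (rule less)
  have "bij_betw (\<lambda>q. (w ^^ q) i) {q. q < n \<and> lexless ?x q p} {1..<(w ^^ p) i}"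
    unfolding bij_betw_def
  proof
    show "inj_on (\<lambda>q. (w ^^ q) i) {q. q < n \<and> lexless ?x q p}"
      using bij_betw_imp_inj_on[OF desc_cycles_bij(1)] by (rule inj_on_subset) auto
    have "(\<lambda>q. (w ^^ q) i) ` {q. q < n \<and> lexless ?x q p} =
        {a \<in> (\<lambda>q. (w ^^ q) i) ` {..<n}. a < (w ^^ p) i}"
      using iff by auto
    also have "\<dots> = {1..<(w ^^ p) i}"
      using desc_cycles_bij(1) desc_cycles_funpow_in[of p] by (auto simp: bij_betw_def)
    finally show "(\<lambda>q. (w ^^ q) i) ` {q. q < n \<and> lexless ?x q p} = {1..<(w ^^ p) i}" .
  qed
  then have "card {q. q < n \<and> lexless ?x q p} = (w ^^ p) i - 1"
    by (simp add: bij_betw_same_card)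
  then show ?thesis using desc_cycles_funpow_in[of p] by (simp add: lexrank_def)
qed

end

lemma cycle_word_inj:
  assumes "finite T"
  shows "inj_on (cycle_word T) (desc_cycles n T \<times> {1..n})"
proof (rule inj_onI, clarify)
  fix w i v j
  assume w: "w \<in> desc_cycles n T" "i \<in> {1..n}" and v: "v \<in> desc_cycles n T" "j \<in> {1..n}"
    and eq: "cycle_word T (w, i) = cycle_word T (v, j)"
  have pow: "(w ^^ p) i = (v ^^ p) j" if "p < n" for p
    using funpow_eq_lexrank[OF assms w that] funpow_eq_lexrank[OF assms v that] eq by simp
  have ij: "i = j" using pow[of 0] w by simp
  have "w a = v a" for a
  proof (cases "a \<in> {1..n}")
    case True
    then have "a \<in> (\<lambda>p. (w ^^ p) i) ` {..<n}"
      using bij_betw_imp_surj_on[OF desc_cycles_bij(1)[OF assms w]] by simp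
    then obtain p where p: "p < n" "a = (w ^^ p) i" by blast
    have "(w ^^ Suc p) i = (v ^^ Suc p) j"
    \<comment> \<open>Ranks determine the iterates at times below \<open>n\<close>; the step after
      time \<open>n - 1\<close> returns to the common starting point.\<close>
    proof (cases "Suc p < n")
      case False
      then have "Suc p = n" using p by simp
      then show ?thesis using desc_cycles_bij(2)[OF assms w] desc_cycles_bij(2)[OF assms v] ij by simp
    qed (rule pow)
    then show ?thesis using p pow[of p] by simp
  next
    case False
    then show ?thesis using w v by (auto simp: desc_cycles_def permutes_not_in)
  qed
  then show "w = v \<and> i = j" using ij by auto
qed

text \<open>A multiset has only one sorted listing. This identifies the sequence of blocks with the
  first letters of the sorted shifts.\<close>

lemma map_eq_if_sorted_mset_eq:
  fixes f g :: "nat \<Rightarrow> nat"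
  assumes "image_mset f (mset_set {1..n}) = image_mset g (mset_set {1..n})"
    and "\<And>i j. 1 \<le> i \<Longrightarrow> i \<le> j \<Longrightarrow> j \<le> n \<Longrightarrow> f i \<le> f j"
    and "\<And>i j. 1 \<le> i \<Longrightarrow> i \<le> j \<Longrightarrow> j \<le> n \<Longrightarrow> g i \<le> g j"
    and "i \<in> {1..n}"
  shows "f i = g i"
proof -
  let ?l = "[1..<Suc n]"
  have m: "mset (map h ?l) = image_mset h (mset_set {1..n})" for h :: "nat \<Rightarrow> nat"
    by (simp only: mset_map mset_upt atLeastLessThanSuc_atLeastAtMost)
  have "sorted (map f ?l)" "sorted (map g ?l)"
    using assms(2,3) by (auto simp: sorted_iff_nth_mono_less simp del: upt_Suc)
  moreover have "mset (map f ?l) = mset (map g ?l)"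
    unfolding m by (rule assms(1))
  ultimately have "map f ?l = map g ?l" by (metis properties_for_sort)
  moreover have "i \<in> set ?l" using assms(4) by auto
  ultimately show ?thesis by (metis map_eq_conv)
qed

section \<open>Reconstruction of a cycle from a primitive word\<close>

context
  fixes n :: nat and T :: "nat set" and x :: "nat \<Rightarrow> nat"
  assumes fin: "finite T" and n: "n > 0" and x: "x \<in> words n T" "primitive n x"
begin

text \<open>In lexicographic order the shifts have weakly increasing first letters, and these
  letters form the block content. The block numbers of \<open>1, ..., n\<close> are weakly
  increasing with the same content, so the two sequences coincide.\<close>

lemma block_lexrank: "block T (lexrank n x p) = x p"
proof -
  have per: "periodic n x" using x by (simp add: words_def)
  let ?r = "lexrank n x"
  have bij: "bij_betw ?r {..<n} {1..n}" using x(2) by (rule lexrank_bij)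
  define s where "s = the_inv_into {..<n} ?r"
  have s: "s a \<in> {..<n}" "?r (s a) = a" if "a \<in> {1..n}" for a
    using that bij unfolding s_def bij_betw_def
    by (auto intro!: the_inv_into_into[of ?r "{..<n}" a "{..<n}", simplified] f_the_inv_into_f)
  have sr: "s (?r p) = p" if "p < n" for p
    using that bij unfolding s_def bij_betw_def by (simp add: the_inv_into_f_f)
  have eq: "block T a = x (s a)" if "a \<in> {1..n}" for a
  proof (rule map_eq_if_sorted_mset_eq[OF _ _ _ that])
    have "mset_set {1..n} = image_mset ?r (mset_set {..<n})"
      using bij by (simp add: image_mset_mset_set bij_betw_def)
    then have "image_mset (\<lambda>a. x (s a)) (mset_set {1..n}) = image_mset (\<lambda>p. x (s (?r p))) (mset_set {..<n})"
      by (simp add: multiset.map_comp o_def)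
    also have "\<dots> = image_mset x (mset_set {..<n})"
      by (rule image_mset_cong) (simp add: sr)
    finally show "image_mset (block T) (mset_set {1..n}) = image_mset (\<lambda>a. x (s a)) (mset_set {1..n})"
      using x(1) by (simp add: words_def block_content_def)
    show "block T i \<le> block T j" if "i \<le> j" for i j using block_mono[OF fin that] .
    show "x (s i) \<le> x (s j)" if ij: "1 \<le> i" "i \<le> j" "j \<le> n" for i j
    proof (rule ccontr)
      assume "\<not> ?thesis"
      \<comment> \<open>A smaller first letter already decides the comparison, at offset 0.\<close>
      then have "lexless x (s j) (s i)" unfolding lexless_def by (intro exI[of _ 0]) simp
      then have "?r (s j) < ?r (s i)" using s[of j] ij by (intro lexrank_less) auto
      then show False using s[of i] s[of j] ij by simp
    qed
  qed
  have "?r (p mod n) \<in> {1..n}" using bij n unfolding bij_betw_def by auto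
  from eq[OF this] have "block T (?r (p mod n)) = x (p mod n)" using sr n by simp
  then show ?thesis
    using periodic_mod[OF per] periodic_mod[OF lexrank_periodic[OF per]] by simp
qed

text \<open>The cycle sends the rank of each shift to the rank of the next shift; it is increasing
  on blocks because shifts with equal first letters keep their order when that letter is
  removed.\<close>

lemma cycle_word_surj: "\<exists>w i. w \<in> desc_cycles n T \<and> i \<in> {1..n} \<and> x = cycle_word T (w, i)"
proof -
  have per: "periodic n x" using x by (simp add: words_def)
  let ?r = "lexrank n x"
  have perr: "periodic n ?r" using per by (rule lexrank_periodic)
  have bij: "bij_betw ?r {..<n} {1..n}" using x(2) by (rule lexrank_bij)
  have surjr: "\<exists>p<n. a = ?r p" if "a \<in> {1..n}" for a
    using that bij_betw_imp_surj_on[OF bij] by (metis (no_types) imageE lessThan_iff)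
  have rin: "?r p \<in> {1..n}" for p
  proof -
    have "?r (p mod n) \<in> {1..n}" using bij n unfolding bij_betw_def by auto
    then show ?thesis using periodic_mod[OF perr] by simp
  qed
  define w where "w a = (if a \<in> {1..n} then ?r (Suc (the_inv_into {..<n} ?r a)) else a)" for a
  have wr: "w (?r p) = ?r (Suc p)" for p
  proof -
    have "the_inv_into {..<n} ?r (?r (p mod n)) = p mod n"
      using bij n by (simp add: the_inv_into_f_f bij_betw_def)
    then have "w (?r (p mod n)) = ?r (Suc (p mod n))" using rin by (simp add: w_def)
    also have "\<dots> = ?r (Suc (p mod n) mod n)" using periodic_mod[OF perr] by simp
    also have "\<dots> = ?r (Suc p)" using periodic_mod[OF perr] by (simp add: mod_Suc_eq)
    finally show ?thesis using periodic_mod[OF perr] by simp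
  qed
  have pow: "(w ^^ p) (?r 0) = ?r p" for p by (induction p) (simp_all add: wr)
  have surj: "{1..n} \<subseteq> w ` {1..n}"
  proof
    fix a assume "a \<in> {1..n}"
    then obtain p where "p < n" "a = ?r p" using surjr by blast
    \<comment> \<open>Adding a full period gives every position a predecessor, including position
      0.\<close>
    then have "a = ?r (Suc (p + n - 1))"
      using perr n by (simp add: periodic_def)
    then have "a = w (?r (p + n - 1))" by (simp add: wr)
    then show "a \<in> w ` {1..n}" using rin by blast
  qed
  have into: "w ` {1..n} \<subseteq> {1..n}" unfolding w_def using rin by auto
  have im: "w ` {1..n} = {1..n}" using surj into by blast
  then have "inj_on w {1..n}" by (intro eq_card_imp_inj_on) simp_all
  then have "bij_betw w {1..n} {1..n}" using im by (simp add: bij_betw_def)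
  then have perm: "w permutes {1..n}" by (rule bij_imp_permutes) (auto simp: w_def)
  have "orbit w (?r 0) = {1..n}"
  proof
    show "orbit w (?r 0) \<subseteq> {1..n}" using perm rin by (rule permutes_orbit_subset)
    show "{1..n} \<subseteq> orbit w (?r 0)"
    proof
      fix a assume "a \<in> {1..n}"
      then obtain p where "p < n" "a = ?r p" using surjr by blast
      \<comment> \<open>An orbit consists of positive iterates, so the point at time 0 is reached at
        time \<open>n\<close>.\<close>
      then have "a = (w ^^ (p + n)) (?r 0)" "p + n > 0"
        using perr n by (simp_all add: periodic_def pow)
      then show "a \<in> orbit w (?r 0)" unfolding orbit_altdef by blast
    qed
  qed
  then have cyc: "cyclic_on w {1..n}" using rin[of 0] by (intro cyclic_on_singleI[of "?r 0"]) auto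
  have "descents n w \<subseteq> T"
    unfolding descents_subset_iff[OF permutes_inj[OF perm] fin]
  proof (intro allI impI)
    fix a b assume ab: "1 \<le> a \<and> a < b \<and> b \<le> n \<and> block T a = block T b"
    then have "a \<in> {1..n}" "b \<in> {1..n}" by auto
    then obtain p q where p: "p < n" "a = ?r p" and q: "q < n" "b = ?r q"
      using surjr by blast
    have "lexless x p q" using ab p q lexrank_less_iff[OF x(2)] by simp
    moreover have "x p = x q" using ab p q block_lexrank by simp
    ultimately have less: "lexless x (Suc p) (Suc q)" by (rule lexless_Suc)
    have "?r (Suc p) < ?r (Suc q)"
    \<comment> \<open>\<open>lexrank_less\<close> needs its smaller position below \<open>n\<close>;
      at the wrap-around, position \<open>n\<close> is replaced by position 0, which carries the
      same shift.\<close>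
    proof (cases "Suc p < n")
      case False
      then have "Suc p = n" using p by simp
      then have "x (Suc p + l) = x (0 + l)" for l
        using per unfolding periodic_def by (metis add.commute add_0)
      then have "lexless x 0 (Suc q)" using less by (simp add: lexless_def)
      then have "?r 0 < ?r (Suc q)" using n by (rule lexrank_less)
      moreover have "?r (Suc p) = ?r 0" using perr \<open>Suc p = n\<close> unfolding periodic_def by (metis add_0)
      ultimately show ?thesis by simp
    qed (rule lexrank_less[OF less])
    then show "w a < w b" using p q wr by simp
  qed
  with perm cyc have "w \<in> desc_cycles n T" by (simp add: desc_cycles_def)
  moreover have "x = cycle_word T (w, ?r 0)"
    by (rule ext) (simp add: cycle_word_def pow block_lexrank)
  ultimately show ?thesis using rin by blast
qed

end

theorem gessel_reutenauer_cycles: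
  assumes "finite T" "n > 0"
  shows "n * card (desc_cycles n T) = card {x \<in> words n T. primitive n x}"
proof -
  have "cycle_word T ` (desc_cycles n T \<times> {1..n}) = {x \<in> words n T. primitive n x}"
  proof
    show "cycle_word T ` (desc_cycles n T \<times> {1..n}) \<subseteq> {x \<in> words n T. primitive n x}"
      using cycle_word_in_words[OF assms(1)] cycle_word_primitive[OF assms(1)] by blast
    show "{x \<in> words n T. primitive n x} \<subseteq> cycle_word T ` (desc_cycles n T \<times> {1..n})"
      using cycle_word_surj[OF assms] by blast
  qed
  then have "card (desc_cycles n T \<times> {1..n}) = card {x \<in> words n T. primitive n x}"
    using card_image[OF cycle_word_inj[OF assms(1), of n]] by simp
  then show ?thesis by (simp add: card_cartesian_product mult.commute)
qed

section \<open>Counting primitive words\<close>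

lemma moebius_mu_prime_mult:
  assumes "prime p" "\<not> p dvd d"
  shows "moebius_mu (p * d) = - moebius_mu d"
proof (cases "squarefree d")
  case True
  have cop: "coprime p d" using assms by (simp add: prime_imp_coprime)
  have "d \<noteq> 0" using assms(2) by (metis dvd_0_right)
  have "prime_factors (p * d) = insert p (prime_factors d)"
    using assms \<open>d \<noteq> 0\<close> by (subst prime_factorization_mult) (auto simp: prime_factorization_prime)
  moreover have "p \<notin> prime_factors d" using assms by (auto simp: in_prime_factors_iff)
  moreover have "squarefree (p * d)"
    using True cop assms(1) by (simp add: squarefree_mult_coprime squarefree_prime)
  ultimately show ?thesis using True by (simp add: moebius_mu_def)
next
  case False
  then have "\<not> squarefree (p * d)" using squarefree_mono[of d "p * d"] by auto
  with False show ?thesis by (simp add: moebius_mu_def)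
qed

lemma moebius_mu_square_dvd: "prime p \<Longrightarrow> p * p dvd d \<Longrightarrow> moebius_mu d = 0"
  unfolding moebius_mu_def squarefree_def by (metis power2_eq_square not_prime_unit)

text \<open>For a prime \<open>p\<close> dividing \<open>n\<close>, multiplication by
  \<open>p\<close> pairs the divisors prime to \<open>p\<close> (\<open>D\<close>) with those
  divisible by \<open>p\<close> exactly once (\<open>E\<close>), with opposite signs. Divisors in
  \<open>F\<close> contribute 0.\<close>

lemma sum_moebius_mu:
  assumes "n > 0"
  shows "(\<Sum>d | d dvd n. moebius_mu d) = (if n = 1 then 1 else 0)"
proof (cases "n = 1")
  case True
  then have "{d. d dvd n} = {1}" by auto
  then show ?thesis using True by (simp add: moebius_mu_def)
next
  case False
  then obtain p where p: "prime p" "p dvd n" using prime_factor_nat by blast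
  define D where "D = {d. d dvd n \<and> \<not> p dvd d}"
  define E where "E = {d. d dvd n \<and> p dvd d \<and> \<not> p * p dvd d}"
  define F where "F = {d. d dvd n \<and> p * p dvd d}"
  have fin: "finite {d. d dvd n}" using assms by simp
  have finD: "finite D" "finite E" "finite F"
    unfolding D_def E_def F_def by (rule finite_subset[OF _ fin]; blast)+
  have "{d. d dvd n} = D \<union> E \<union> F" unfolding D_def E_def F_def using dvd_mult_left by blast
  moreover have "D \<inter> E = {}" "(D \<union> E) \<inter> F = {}" unfolding D_def E_def F_def using dvd_mult_left by blast+
  ultimately have "(\<Sum>d | d dvd n. moebius_mu d) =
      (\<Sum>d\<in>D. moebius_mu d) + (\<Sum>d\<in>E. moebius_mu d) + (\<Sum>d\<in>F. moebius_mu d)"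
    using finD by (simp add: sum.union_disjoint)
  also have "(\<Sum>d\<in>F. moebius_mu d) = 0"
    using moebius_mu_square_dvd[OF p(1)] by (intro sum.neutral) (auto simp: F_def)
  also have "(\<Sum>d\<in>E. moebius_mu d) = (\<Sum>d\<in>D. moebius_mu (p * d))"
  proof -
    have p0: "p > 0" using p(1) prime_gt_0_nat by blast
    have "E = (\<lambda>d. p * d) ` D"
    proof (intro equalityI subsetI)
      fix e assume "e \<in> E"
      then obtain d where "e = p * d" "e dvd n" "\<not> p * p dvd e" by (auto simp: E_def)
      moreover from this have "d dvd n" "\<not> p dvd d" by (auto intro: dvd_mult_right mult_dvd_mono)
      ultimately show "e \<in> (\<lambda>d. p * d) ` D" by (auto simp: D_def)
    next
      fix e assume "e \<in> (\<lambda>d. p * d) ` D"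
      then obtain d where d: "e = p * d" "d dvd n" "\<not> p dvd d" by (auto simp: D_def)
      moreover have "coprime p d" using d p by (simp add: prime_imp_coprime)
      ultimately show "e \<in> E" using p p0 by (simp add: E_def divides_mult)
    qed
    moreover have "inj_on (\<lambda>d. p * d) D" using p0 by (auto intro: inj_onI)
    ultimately show ?thesis by (simp add: sum.reindex)
  qed
  also have "\<dots> = (\<Sum>d\<in>D. - moebius_mu d)"
    by (rule sum.cong) (auto simp: D_def moebius_mu_prime_mult p)
  finally show ?thesis using False by (simp add: sum_negf)
qed

text \<open>By \<open>periodic_gcd\<close> the positive periods of \<open>x\<close> are the
  multiples of the least one, \<open>e\<close>. Thus \<open>n div d\<close> is a period iff
  \<open>d\<close> divides \<open>n div e\<close>, and the Moebius sum tests whether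
  \<open>e = n\<close>.\<close>

lemma sum_moebius_mu_periods:
  assumes per: "periodic n x" and n: "n > 0"
  shows "(\<Sum>d | d dvd n \<and> periodic (n div d) x. moebius_mu d) = (if primitive n x then 1 else 0)"
proof -
  define e where "e = (LEAST e. e > 0 \<and> periodic e x)"
  have e: "e > 0 \<and> periodic e x" 
    unfolding e_def using per n LeastI[of "\<lambda>e. e > 0 \<and> periodic e x" n] by simp
  have least: "e \<le> k" if "k > 0" "periodic k x" for k
    unfolding e_def using that by (simp add: Least_le)
  have dvd: "e dvd m" if "m > 0" "periodic m x" for m
  proof -
    have "periodic (gcd e m) x" using e that by (intro periodic_gcd) auto
    then have "e \<le> gcd e m" using that by (intro least) auto
    moreover have "gcd e m \<le> e" using e by (intro gcd_le1_nat) simp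
    ultimately have "gcd e m = e" by simp
    then show ?thesis by (metis gcd_dvd2)
  qed
  have en: "e dvd n" using dvd per n by simp
  have "{d. d dvd n \<and> periodic (n div d) x} = {d. d dvd n div e}"
  proof (intro equalityI subsetI CollectI)
    fix d assume "d \<in> {d. d dvd n \<and> periodic (n div d) x}"
    then have d: "d dvd n" "periodic (n div d) x" by auto
    have "n div d > 0" using d n by (simp add: div_greater_zero_iff dvd_imp_le dvd_pos_nat)
    then have "e dvd n div d" using d dvd by simp
    then have "e * d dvd n div d * d" by (rule mult_dvd_mono) simp
    then have "d * e dvd n" using d by (simp add: mult.commute)
    then show "d dvd n div e" by (rule dvd_mult_imp_div)
  next
    fix d assume "d \<in> {d. d dvd n div e}"
    then obtain c where c: "n div e = d * c" by auto
    have "n div e * e = n" using en by simp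
    with c have nn: "n = d * (c * e)" by (simp add: mult.assoc)
    then have "d > 0" using n by (metis gr0I mult_0)
    then have "n div d = c * e" unfolding nn by simp
    moreover have "d dvd n" unfolding nn by simp
    ultimately show "d dvd n \<and> periodic (n div d) x" using e by (simp add: periodic_mult)
  qed
  moreover have "n div e > 0" using en n by (simp add: div_greater_zero_iff dvd_imp_le dvd_pos_nat)
  moreover have "n div e = 1 \<longleftrightarrow> primitive n x"
  proof
    assume "n div e = 1"
    moreover have "n div e * e = n" using en by simp
    ultimately have "n = e" by simp
    then show "primitive n x" unfolding primitive_def using e least by (metis not_less)
  next
    assume "primitive n x"
    then have "\<not> e < n" using e by (auto simp: primitive_def)
    then have "e = n" using en n by (simp add: dvd_imp_le le_antisym)
    then show "n div e = 1" using n by simp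
  qed
  ultimately show ?thesis by (simp add: sum_moebius_mu)
qed

lemma words_bij_permutations:
  assumes "n > 0"
  shows "bij_betw (\<lambda>x. map x [0..<n]) (words n T) (permutations_of_multiset (block_content n T))"
proof (rule bij_betw_byWitness[where f' = "\<lambda>xs p. xs ! (p mod n)"])
  have m: "mset (map x [0..<n]) = image_mset x (mset_set {..<n})" for x :: "nat \<Rightarrow> nat"
    by (simp only: mset_map mset_upt atLeast0LessThan)
  show "\<forall>x\<in>words n T. (\<lambda>p. map x [0..<n] ! (p mod n)) = x"
    using assms by (auto simp: words_def periodic_mod)
  have len: "length xs = n" if "xs \<in> permutations_of_multiset (block_content n T)" for xs
  proof -
    have "size (mset xs) = n"
      using permutations_of_multisetD[OF that] by (simp add: block_content_def)
    then show ?thesis by simp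
  qed
  have inv: "map (\<lambda>p. xs ! (p mod n)) [0..<n] = xs" if "length xs = n" for xs :: "nat list"
    using that by (intro nth_equalityI) auto
  show "\<forall>xs\<in>permutations_of_multiset (block_content n T). map (\<lambda>p. xs ! (p mod n)) [0..<n] = xs"
    using len inv by blast
  show "(\<lambda>x. map x [0..<n]) ` words n T \<subseteq> permutations_of_multiset (block_content n T)"
    by (auto simp: words_def m permutations_of_multiset_def simp del: mset_map)
  show "(\<lambda>xs p. xs ! (p mod n)) ` permutations_of_multiset (block_content n T) \<subseteq> words n T"
  proof
    fix x assume "x \<in> (\<lambda>xs p. xs ! (p mod n)) ` permutations_of_multiset (block_content n T)"
    then obtain xs where xs: "xs \<in> permutations_of_multiset (block_content n T)" and x: "x = (\<lambda>p. xs ! (p mod n))"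
      by blast
    have "image_mset x (mset_set {..<n}) = mset xs"
      unfolding m[symmetric] x by (simp only: inv[OF len[OF xs]])
    then show "x \<in> words n T"
      using permutations_of_multisetD[OF xs] by (simp add: words_def periodic_def x)
  qed
qed

lemma finite_words: "n > 0 \<Longrightarrow> finite (words n T)"
  using bij_betw_finite[OF words_bij_permutations] by simp

text \<open>For cuts in \<open>{1..<n}\<close> this is the multinomial coefficient of the block
  sizes.\<close>

definition word_count :: "nat \<Rightarrow> nat set \<Rightarrow> nat" where
  "word_count n T = card (permutations_of_multiset (block_content n T))"

lemma card_words: "n > 0 \<Longrightarrow> card (words n T) = word_count n T"
  unfolding word_count_def by (rule bij_betw_same_card[OF words_bij_permutations])

text \<open>The indicator of primitivity is replaced by its Moebius sum over periods, and the two
  summations are exchanged.\<close>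

lemma card_primitive_words:
  assumes "n > 0"
  shows "int (card {x \<in> words n T. primitive n x}) =
    (\<Sum>d | d dvd n. moebius_mu d * int (card {x \<in> words n T. periodic (n div d) x}))"
proof -
  note fin = finite_words[OF assms, of T]
  have find: "finite {d. d dvd n}" using assms by simp
  have "int (card {x \<in> words n T. primitive n x}) = (\<Sum>x\<in>words n T. if primitive n x then 1 else 0)"
    using fin by (simp add: sum.If_cases Int_def conj_commute)
  also have "\<dots> = (\<Sum>x\<in>words n T. \<Sum>d | d dvd n \<and> periodic (n div d) x. moebius_mu d)"
    by (intro sum.cong refl) (simp add: sum_moebius_mu_periods words_def assms)
  also have "\<dots> = (\<Sum>x\<in>words n T. \<Sum>d | d dvd n. if periodic (n div d) x then moebius_mu d else 0)"
  proof (rule sum.cong)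
    fix x
    show "(\<Sum>d | d dvd n \<and> periodic (n div d) x. moebius_mu d) =
        (\<Sum>d | d dvd n. if periodic (n div d) x then moebius_mu d else 0)"
      using sum.inter_filter[OF find, of moebius_mu "\<lambda>d. periodic (n div d) x"] by simp
  qed simp
  also have "\<dots> = (\<Sum>d | d dvd n. \<Sum>x\<in>words n T. if periodic (n div d) x then moebius_mu d else 0)"
    by (rule sum.swap)
  also have "\<dots> = (\<Sum>d | d dvd n. moebius_mu d * int (card {x \<in> words n T. periodic (n div d) x}))"
    using fin by (intro sum.cong refl) (simp add: sum.If_cases Int_def conj_commute mult.commute)
  finally show ?thesis .
qed

section \<open>Contents of words with a smaller period\<close>

lemma image_mset_mod_interval:
  assumes "e > 0"
  shows "image_mset (\<lambda>p. p mod e) (mset_set {..<d * e}) = repeat_mset d (mset_set {..<e})"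
proof (induction d)
  case (Suc d)
  have "{..<Suc d * e} = {..<d * e} \<union> (\<lambda>p. d * e + p) ` {..<e}"
  proof (intro equalityI subsetI)
    fix p assume "p \<in> {..<Suc d * e}"
    then show "p \<in> {..<d * e} \<union> (\<lambda>p. d * e + p) ` {..<e}"
      by (cases "p < d * e") (auto intro!: image_eqI[of _ _ "p - d * e"])
  qed auto
  then have "mset_set {..<Suc d * e} = mset_set {..<d * e} + mset_set ((\<lambda>p. d * e + p) ` {..<e})"
    by (simp only:) (rule mset_set_Union; auto)
  also have "mset_set ((\<lambda>p. d * e + p) ` {..<e}) = image_mset (\<lambda>p. d * e + p) (mset_set {..<e})"
    by (rule image_mset_mset_set[symmetric]) (auto intro: inj_onI)
  finally have "image_mset (\<lambda>p. p mod e) (mset_set {..<Suc d * e}) =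
      repeat_mset d (mset_set {..<e}) + image_mset (\<lambda>p. (d * e + p) mod e) (mset_set {..<e})"
    by (simp add: Suc.IH multiset.map_comp o_def)
  also have "image_mset (\<lambda>p. (d * e + p) mod e) (mset_set {..<e}) = image_mset (\<lambda>p. p) (mset_set {..<e})"
    by (rule image_mset_cong) simp
  finally show ?case by simp
qed simp

lemma image_mset_periodic:
  assumes "periodic e x" "e > 0"
  shows "image_mset x (mset_set {..<d * e}) = repeat_mset d (image_mset x (mset_set {..<e}))"
proof -
  have "image_mset x (mset_set {..<d * e}) = image_mset x (image_mset (\<lambda>p. p mod e) (mset_set {..<d * e}))"
    by (simp add: multiset.map_comp o_def periodic_mod[OF assms(1)])
  moreover have "image_mset x (repeat_mset d M) = repeat_mset d (image_mset x M)" for M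
    by (induction d) simp_all
  ultimately show ?thesis by (simp add: image_mset_mod_interval[OF assms(2)])
qed

lemma mset_set_Suc_image: "mset_set {1..n} = image_mset Suc (mset_set {..<n})"
  by (simp add: image_mset_mset_set image_Suc_lessThan)

lemma block_content_conv_lessThan: "block_content n T = image_mset (\<lambda>p. block T (Suc p)) (mset_set {..<n})"
  unfolding block_content_def mset_set_Suc_image by (simp add: multiset.map_comp o_def)

lemma image_mset_div_interval:
  assumes "d > 0"
  shows "image_mset (\<lambda>p. p div d) (mset_set {..<d * e}) = repeat_mset d (mset_set {..<e})"
proof (induction e)
  case (Suc e)
  have "{..<d * Suc e} = {..<d * e} \<union> (\<lambda>p. d * e + p) ` {..<d}"
  proof (intro equalityI subsetI)
    fix p assume "p \<in> {..<d * Suc e}"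
    then show "p \<in> {..<d * e} \<union> (\<lambda>p. d * e + p) ` {..<d}"
      by (cases "p < d * e") (auto intro!: image_eqI[of _ _ "p - d * e"])
  qed auto
  then have "mset_set {..<d * Suc e} = mset_set {..<d * e} + mset_set ((\<lambda>p. d * e + p) ` {..<d})"
    by (simp only:) (rule mset_set_Union; auto)
  also have "mset_set ((\<lambda>p. d * e + p) ` {..<d}) = image_mset (\<lambda>p. d * e + p) (mset_set {..<d})"
    by (rule image_mset_mset_set[symmetric]) (auto intro: inj_onI)
  finally have "image_mset (\<lambda>p. p div d) (mset_set {..<d * Suc e}) =
      repeat_mset d (mset_set {..<e}) + image_mset (\<lambda>p. (d * e + p) div d) (mset_set {..<d})"
    by (simp add: Suc.IH multiset.map_comp o_def)
  also have "image_mset (\<lambda>p. (d * e + p) div d) (mset_set {..<d}) = image_mset (\<lambda>p. e) (mset_set {..<d})"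
    using assms by (intro image_mset_cong) simp
  also have "\<dots> = repeat_mset d {#e#}" by (simp add: image_mset_const_eq)
  finally show ?case by (simp add: lessThan_Suc)
qed simp

text \<open>Dilating the cuts by \<open>d\<close> makes every block \<open>d\<close> times as long.
  Counted from 0, position \<open>p\<close> falls into the block that \<open>p div d\<close> had
  before.\<close>

lemma block_content_mult:
  assumes "finite T" "d > 0"
  shows "block_content (d * e) ((*) d ` T) = repeat_mset d (block_content e T)"
proof -
  have "block ((*) d ` T) (Suc p) = block T (Suc (p div d))" for p
  proof -
    have "{t \<in> (*) d ` T. t < Suc p} = (*) d ` {t \<in> T. t < Suc (p div d)}"
      using assms(2) by (auto simp: less_Suc_eq_le less_eq_div_iff_mult_less_eq mult.commute)
    then show ?thesis
      unfolding block_def using assms(2) by (simp add: card_image inj_on_def)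
  qed
  then have "block_content (d * e) ((*) d ` T) =
      image_mset (\<lambda>p. block T (Suc p)) (image_mset (\<lambda>p. p div d) (mset_set {..<d * e}))"
    unfolding block_content_conv_lessThan by (simp add: multiset.map_comp o_def)
  moreover have "image_mset f (repeat_mset d M) = repeat_mset d (image_mset f M)" for f :: "nat \<Rightarrow> nat" and M
    by (induction d) simp_all
  ultimately show ?thesis by (simp add: image_mset_div_interval[OF assms(2)] block_content_conv_lessThan)
qed

text \<open>A cut \<open>t\<close> ends its block, so exactly \<open>t\<close> letters of the
  content are at most \<open>block T t\<close>; in a \<open>d\<close>-fold multiset this number is a
  multiple of \<open>d\<close>.\<close>

lemma dvd_if_content_repeat:
  assumes "finite T" "T \<subseteq> {1..<n}" "block_content n T = repeat_mset d M" "t \<in> T"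
  shows "d dvd t"
proof -
  have eq: "{i \<in> {1..n}. block T i \<le> block T t} = {1..t}"
    using assms(2,4) block_mono[OF assms(1)] block_less[OF assms(1,4) order_refl]
    by (auto simp: not_le[symmetric] intro: ccontr)
  have "size (filter_mset (\<lambda>a. a \<le> block T t) (block_content n T)) = card {i \<in> {1..n}. block T i \<le> block T t}"
    by (simp add: block_content_def filter_mset_image_mset o_def)
  then have "t = size (filter_mset (\<lambda>a. a \<le> block T t) (block_content n T))" unfolding eq by simp
  also have "filter_mset P (repeat_mset d M) = repeat_mset d (filter_mset P M)" for P
    by (induction d) simp_all
  then have "size (filter_mset (\<lambda>a. a \<le> block T t) (block_content n T)) = d * size (filter_mset (\<lambda>a. a \<le> block T t) M)"
    unfolding assms(3) by simp
  finally show ?thesis by (metis dvd_triv_left)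
qed

text \<open>A word of period \<open>n div d\<close> runs \<open>d\<close> times through its first
  \<open>n div d\<close> letters, so its content is a \<open>d\<close>-fold multiset. This forces
  all cuts to be multiples of \<open>d\<close>, and dividing them by \<open>d\<close> describes the
  content of one run.\<close>

lemma card_periodic_words:
  assumes "n > 0" "d dvd n" "T \<subseteq> {1..<n}"
  shows "card {x \<in> words n T. periodic (n div d) x} =
    (if \<forall>t\<in>T. d dvd t then word_count (n div d) {t. d * t \<in> T} else 0)"
proof -
  obtain e where n: "n = d * e" using assms(2) by blast
  then have de: "d > 0" "e > 0" "n div d = e" using assms(1) by auto
  have finT: "finite T" using assms(3) finite_subset by blast
  have rep: "image_mset x (mset_set {..<n}) = repeat_mset d (image_mset x (mset_set {..<e}))"
    if "periodic e x" for x :: "nat \<Rightarrow> nat"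
    using image_mset_periodic[OF that de(2)] n by simp
  show ?thesis
  proof (cases "\<forall>t\<in>T. d dvd t")
    case True
    define U where "U = {t. d * t \<in> T}"
    have T: "T = (*) d ` U" using True by (auto simp: U_def image_iff elim!: dvdE)
    have finU: "finite U" using finT de(1) unfolding T by (subst (asm) finite_image_iff) (auto simp: inj_on_def)
    have "{x \<in> words n T. periodic e x} = words e U"
      using rep block_content_mult[OF finU de(1), of e] de n periodic_mult[of e _ d]
      by (auto simp: words_def T[symmetric] repeat_mset_cancel1)
    then show ?thesis using True de card_words[of e U] by (simp add: U_def)
  next
    case False
    have "{x \<in> words n T. periodic e x} = {}"
    proof (rule ccontr)
      assume "\<not> ?thesis"
      then obtain x where "x \<in> words n T" "periodic e x" by blast
      then have "block_content n T = repeat_mset d (image_mset x (mset_set {..<e}))"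
        using rep[of x] by (simp add: words_def)
      then show False using dvd_if_content_repeat[OF finT assms(3)] False by blast
    qed
    then have "card {x \<in> words n T. periodic (n div d) x} = 0" unfolding de(3) by (simp only: card.empty)
    then show ?thesis using False by (simp only: if_False)
  qed
qed

section \<open>Multinomial coefficients and removal of the last block\<close>

lemma card_permutations_add_replicate:
  assumes "a \<notin># M"
  shows "card (permutations_of_multiset (M + replicate_mset k a)) =
    (size M + k choose k) * card (permutations_of_multiset M)"
proof (cases "k = 0")
  case False
  let ?N = "M + replicate_mset k a"
  have 1: "set_mset ?N = insert a (set_mset M)" using False by auto
  have "(\<Prod>x\<in>set_mset ?N. fact (count ?N x)) = fact k * (\<Prod>x\<in>set_mset M. fact (count ?N x) :: nat)"
    unfolding 1 using assms by (simp add: not_in_iff)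
  also have "(\<Prod>x\<in>set_mset M. fact (count ?N x) :: nat) = (\<Prod>x\<in>set_mset M. fact (count M x))"
    using assms by (intro prod.cong) auto
  \<comment> \<open>After multiplication by the factorials of all multiplicities, both sides of the
    claim become \<open>fact (size M + k)\<close>.\<close>
  finally have "card (permutations_of_multiset ?N) * (fact k * (\<Prod>x\<in>set_mset M. fact (count M x))) = fact (size M + k)"
    using card_permutations_of_multiset_aux[of ?N] by simp
  also have "\<dots> = fact k * fact (size M) * (size M + k choose k)"
    using binomial_fact_lemma[of k "size M + k"] by simp
  also have "\<dots> = (size M + k choose k) * card (permutations_of_multiset M) *
      (fact k * (\<Prod>x\<in>set_mset M. fact (count M x)))"
    using card_permutations_of_multiset_aux[of M] by (simp add: ac_simps)
  finally show ?thesis by (subst (asm) mult_right_cancel) auto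
qed simp

lemma word_count_empty: "word_count n {} = 1"
proof -
  have "block_content n {} = {#} + replicate_mset n 0"
    unfolding block_content_def block_def by (simp add: image_mset_const_eq)
  then show ?thesis
    using card_permutations_add_replicate[of 0 "{#}" n] by (simp add: word_count_def)
qed

text \<open>The block after the largest cut \<open>b\<close> consists of \<open>n - b\<close> copies
  of a letter that is absent before. Choosing the places of the remaining \<open>b\<close> letters
  leaves a word for \<open>b\<close> and \<open>T\<close>.\<close>

lemma word_count_insert:
  assumes "T \<subseteq> {1..<b}" "b < n"
  shows "word_count n (insert b T) = (n choose b) * word_count b T"
proof -
  have finT: "finite T" using assms(1) finite_subset by blast
  have un: "{1..n} = {1..b} \<union> {Suc b..n}" using assms by auto
  have "mset_set {1..n} = mset_set {1..b} + mset_set {Suc b..n}"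
    unfolding un by (rule mset_set_Union) auto
  then have "block_content n (insert b T) = image_mset (block (insert b T)) (mset_set {1..b}) +
      image_mset (block (insert b T)) (mset_set {Suc b..n})"
    by (simp add: block_content_def)
  also have "image_mset (block (insert b T)) (mset_set {1..b}) = block_content b T"
    unfolding block_content_def
  proof (rule image_mset_cong)
    fix i assume "i \<in># mset_set {1..b}"
    then have "{t \<in> insert b T. t < i} = {t \<in> T. t < i}" by auto
    then show "block (insert b T) i = block T i" by (simp add: block_def)
  qed
  also have "image_mset (block (insert b T)) (mset_set {Suc b..n}) =
      image_mset (\<lambda>_. Suc (card T)) (mset_set {Suc b..n})"
  proof (rule image_mset_cong)
    fix i assume "i \<in># mset_set {Suc b..n}"
    then have "{t \<in> insert b T. t < i} = insert b T" using assms(1) by auto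
    moreover have "b \<notin> T" using assms(1) by auto
    ultimately show "block (insert b T) i = Suc (card T)" using finT by (simp add: block_def)
  qed
  finally have eq: "block_content n (insert b T) = block_content b T + replicate_mset (n - b) (Suc (card T))"
    by (simp add: image_mset_const_eq)
  have "block T i \<noteq> Suc (card T)" for i
  proof -
    have "block T i \<le> card T" unfolding block_def using finT by (intro card_mono) auto
    then show ?thesis by simp
  qed
  then have "Suc (card T) \<notin># block_content b T" 
    unfolding block_content_def by (metis (no_types, lifting) imageE set_image_mset)
  from card_permutations_add_replicate[OF this, of "n - b"]
  show ?thesis using assms(2) binomial_symmetric[of b n]
    by (simp add: word_count_def eq) (simp add: block_content_def)
qed

section \<open>Exact descent sets\<close>

text \<open>Up to the sign \<open>(- 1) ^ card S\<close>, this is the number of permutations with descent set \<open>S\<close>.\<close>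

definition ribbon_sum :: "nat \<Rightarrow> nat set \<Rightarrow> real" where
  "ribbon_sum n S = (\<Sum>T\<in>Pow S. (- 1) ^ card T * real (word_count n T))"

lemma ribbon_sum_empty: "ribbon_sum n {} = 1"
  by (simp add: ribbon_sum_def word_count_empty)

text \<open>Classify the subsets by their largest element \<open>t\<close>: the last block
  contributes \<open>n choose t\<close>, the element \<open>t\<close> itself a sign, and the rest is
  a subset of the part of \<open>S\<close> below \<open>t\<close>. The empty subset gives the
  1.\<close>

lemma ribbon_sum_rec:
  assumes "S \<subseteq> {1..<n}"
  shows "ribbon_sum n S = 1 - (\<Sum>t\<in>S. real (n choose t) * ribbon_sum t {s \<in> S. s < t})"
proof -
  have "finite S" using assms finite_subset by blast
  then show ?thesis using assms
  proof (induction S rule: finite_linorder_max_induct)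
    case empty
    then show ?case by (simp add: ribbon_sum_empty)
  next
    case (insert b A)
    have b: "b \<notin> A" using insert.hyps by auto
    have wc: "word_count n (insert b T) = (n choose b) * word_count b T" if "T \<in> Pow A" for T
    proof (rule word_count_insert)
      show "T \<subseteq> {1..<b}"
      proof
        fix t assume "t \<in> T"
        then have "t \<in> A" using that by auto
        then show "t \<in> {1..<b}" using insert.hyps insert.prems by auto
      qed
    qed (use insert.prems in auto)
    have "ribbon_sum n (insert b A) = ribbon_sum n A +
        (\<Sum>T\<in>insert b ` Pow A. (- 1) ^ card T * real (word_count n T))"
      unfolding ribbon_sum_def Pow_insert using insert.hyps b
      by (intro sum.union_disjoint) auto
    also have "(\<Sum>T\<in>insert b ` Pow A. (- 1) ^ card T * real (word_count n T)) =
        (\<Sum>T\<in>Pow A. (- 1) ^ card (insert b T) * real (word_count n (insert b T)))"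
      using b by (subst sum.reindex) (auto simp: inj_on_def)
    also have "\<dots> = (\<Sum>T\<in>Pow A. - real (n choose b) * ((- 1) ^ card T * real (word_count b T)))"
    proof (rule sum.cong)
      fix T assume T: "T \<in> Pow A"
      then have "finite T" "b \<notin> T" using insert.hyps b finite_subset by auto
      then show "(- 1) ^ card (insert b T) * real (word_count n (insert b T)) =
          - real (n choose b) * ((- 1) ^ card T * real (word_count b T))"
        using wc[OF T] by simp
    qed simp
    also have "\<dots> = - real (n choose b) * ribbon_sum b A"
      unfolding ribbon_sum_def by (rule sum_distrib_left[symmetric])
    also have "ribbon_sum n A = 1 - (\<Sum>t\<in>A. real (n choose t) * ribbon_sum t {s \<in> A. s < t})"
      using insert by auto
    also have "(\<Sum>t\<in>A. real (n choose t) * ribbon_sum t {s \<in> A. s < t}) =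
        (\<Sum>t\<in>A. real (n choose t) * ribbon_sum t {s \<in> insert b A. s < t})"
    proof (rule sum.cong)
      fix t assume "t \<in> A"
      then have "{s \<in> A. s < t} = {s \<in> insert b A. s < t}" using insert.hyps by auto
      then show "real (n choose t) * ribbon_sum t {s \<in> A. s < t} =
        real (n choose t) * ribbon_sum t {s \<in> insert b A. s < t}" by simp
    qed simp
    also have "A = {s \<in> insert b A. s < b}" using insert.hyps by auto
    then have "ribbon_sum b A = ribbon_sum b {s \<in> insert b A. s < b}" by simp
    finally show ?case using insert.hyps b by simp
  qed
qed

definition cycles_with_descents :: "nat \<Rightarrow> nat set \<Rightarrow> (nat \<Rightarrow> nat) set" where
  "cycles_with_descents n S = {w. w permutes {1..n} \<and> cyclic_on w {1..n} \<and> descents n w = S}"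

lemma card_desc_cycles:
  assumes "finite T"
  shows "card (desc_cycles n T) = (\<Sum>S\<in>Pow T. card (cycles_with_descents n S))"
proof -
  have fin: "finite (cycles_with_descents n S)" for S
    by (rule finite_subset[OF _ finite_permutations[of "{1..n}"]]) (auto simp: cycles_with_descents_def)
  have "desc_cycles n T = (\<Union>S\<in>Pow T. cycles_with_descents n S)"
    by (auto simp: desc_cycles_def cycles_with_descents_def)
  also have "card \<dots> = (\<Sum>S\<in>Pow T. card (cycles_with_descents n S))"
    using assms fin by (intro card_UN_disjoint) (auto simp: cycles_with_descents_def)
  finally show ?thesis .
qed

text \<open>Only sets of multiples of \<open>d\<close> contribute, and these are the dilations of
  the subsets of \<open>{t. d * t \<in> S}\<close>; dilation preserves cardinality and hence the
  sign.\<close>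

lemma sum_dilated_subsets:
  assumes "finite S" "d > 0"
  shows "(\<Sum>T\<in>Pow S. (- 1) ^ card T * real (if \<forall>t\<in>T. d dvd t then word_count n {t. d * t \<in> T} else 0)) =
    ribbon_sum n {t. d * t \<in> S}"
proof -
  let ?U = "{t. d * t \<in> S}"
  have inj: "inj ((*) d)" using assms(2) by (simp add: inj_on_def)
  have "(\<Sum>T\<in>Pow S. (- 1) ^ card T * real (if \<forall>t\<in>T. d dvd t then word_count n {t. d * t \<in> T} else 0)) =
      (\<Sum>T\<in>image ((*) d) ` Pow ?U. (- 1) ^ card T * real (if \<forall>t\<in>T. d dvd t then word_count n {t. d * t \<in> T} else 0))"
  proof (rule sum.mono_neutral_right)
    show "finite (Pow S)" using assms by simp
    show "image ((*) d) ` Pow ?U \<subseteq> Pow S" by auto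
    show "\<forall>T\<in>Pow S - image ((*) d) ` Pow ?U. (- 1) ^ card T *
        real (if \<forall>t\<in>T. d dvd t then word_count n {t. d * t \<in> T} else 0) = 0"
    proof
      fix T assume T: "T \<in> Pow S - image ((*) d) ` Pow ?U"
      have "\<not> (\<forall>t\<in>T. d dvd t)"
      proof
        assume "\<forall>t\<in>T. d dvd t"
        then have "T = (*) d ` {t. d * t \<in> T}" by (auto simp: image_iff elim!: dvdE)
        moreover have "{t. d * t \<in> T} \<in> Pow ?U" using T by auto
        ultimately show False using T by blast
      qed
      then show "(- 1) ^ card T *
        real (if \<forall>t\<in>T. d dvd t then word_count n {t. d * t \<in> T} else 0) = 0"
        by (simp only: if_False of_nat_0 mult_zero_right)
    qed
  qed
  also have "\<dots> = (\<Sum>U\<in>Pow ?U. (- 1) ^ card ((*) d ` U) *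
      real (if \<forall>t\<in>(*) d ` U. d dvd t then word_count n {t. d * t \<in> (*) d ` U} else 0))"
    by (subst sum.reindex) (use inj in \<open>auto simp: inj_on_def inj_image_eq_iff\<close>)
  also have "\<dots> = (\<Sum>U\<in>Pow ?U. (- 1) ^ card U * real (word_count n U))"
  proof (rule sum.cong)
    fix U
    have "card ((*) d ` U) = card U" using inj by (intro card_image) (auto simp: inj_on_def)
    moreover have "{t. d * t \<in> (*) d ` U} = U" using assms(2) by auto
    ultimately show "(- 1) ^ card ((*) d ` U) *
      real (if \<forall>t\<in>(*) d ` U. d dvd t then word_count n {t. d * t \<in> (*) d ` U} else 0) =
      (- 1) ^ card U * real (word_count n U)" by simp
  qed simp
  finally show ?thesis by (simp add: ribbon_sum_def)
qed

text \<open>Inclusion-exclusion over \<open>T \<subseteq> S\<close> reduces to descents contained in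
  \<open>T\<close>, where the bijection and the Moebius count apply. After exchanging the sums, the
  inner sum for each \<open>d\<close> is a ribbon sum of the contracted set.\<close>

theorem card_cycles_with_descents:
  assumes "n > 0" "S \<subseteq> {1..<n}"
  shows "real n * real (card (cycles_with_descents n S)) =
    (- 1) ^ card S * (\<Sum>d | d dvd n. of_int (moebius_mu d) * ribbon_sum (n div d) {t. d * t \<in> S})"
proof -
  have finS: "finite S" using assms(2) finite_subset by blast
  let ?p = "\<lambda>d T. real (if \<forall>t\<in>T. d dvd t then word_count (n div d) {t. d * t \<in> T} else 0)"
  have g: "real n * real (card (desc_cycles n T)) = (\<Sum>d | d dvd n. of_int (moebius_mu d) * ?p d T)"
    if "T \<in> Pow S" for T
  proof -
    have T: "T \<subseteq> {1..<n}" "finite T" using that assms(2) finS finite_subset by auto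
    have "real n * real (card (desc_cycles n T)) = of_int (int (card {x \<in> words n T. primitive n x}))"
      using gessel_reutenauer_cycles[OF T(2) assms(1)] by (simp flip: of_nat_mult)
    also have "\<dots> = (\<Sum>d | d dvd n. of_int (moebius_mu d) * real (card {x \<in> words n T. periodic (n div d) x}))"
      unfolding card_primitive_words[OF assms(1)] by simp
    also have "\<dots> = (\<Sum>d | d dvd n. of_int (moebius_mu d) * ?p d T)"
      using card_periodic_words[OF assms(1) _ T(1)] by (intro sum.cong) simp_all
    finally show ?thesis .
  qed
  have "real (card (cycles_with_descents n S)) =
      (\<Sum>T\<in>Pow S. (- 1) ^ (card S - card T) * real (card (desc_cycles n T)))"
    using finS by (intro inclusion_exclusion_mobius) (simp_all add: card_desc_cycles)
  also have "\<dots> = (\<Sum>T\<in>Pow S. (- 1) ^ card S * ((- 1) ^ card T * real (card (desc_cycles n T))))"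
  proof (rule sum.cong)
    fix T assume "T \<in> Pow S"
    then have "card T \<le> card S" using finS by (intro card_mono) auto
    \<comment> \<open>Difference and sum of the cardinalities have the same parity, so the sign of
      \<open>S\<close> can be pulled out of the sum.\<close>
    then have "(- 1 :: real) ^ (card S - card T) = (- 1) ^ card S * (- 1) ^ card T"
      by (metis neg_one_power_add_eq_neg_one_power_diff power_add)
    then show "(- 1) ^ (card S - card T) * real (card (desc_cycles n T)) =
        (- 1) ^ card S * ((- 1) ^ card T * real (card (desc_cycles n T)))" by simp
  qed simp
  finally have "real n * real (card (cycles_with_descents n S)) =
      (- 1) ^ card S * (\<Sum>T\<in>Pow S. (- 1) ^ card T * (real n * real (card (desc_cycles n T))))"
    by (simp add: sum_distrib_left ac_simps)
  also have "(\<Sum>T\<in>Pow S. (- 1) ^ card T * (real n * real (card (desc_cycles n T)))) =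
      (\<Sum>T\<in>Pow S. \<Sum>d | d dvd n. of_int (moebius_mu d) * ((- 1) ^ card T * ?p d T))"
    by (intro sum.cong refl) (simp only: g sum_distrib_left mult.left_commute)
  also have "\<dots> = (\<Sum>d | d dvd n. \<Sum>T\<in>Pow S. of_int (moebius_mu d) * ((- 1) ^ card T * ?p d T))"
    by (rule sum.swap)
  also have "\<dots> = (\<Sum>d | d dvd n. of_int (moebius_mu d) * ribbon_sum (n div d) {t. d * t \<in> S})"
  proof (rule sum.cong)
    fix d assume "d \<in> {d. d dvd n}"
    then have "d > 0" using assms(1) by (auto intro: dvd_pos_nat)
    from sum_dilated_subsets[OF finS this, of "n div d"]
    show "(\<Sum>T\<in>Pow S. of_int (moebius_mu d) * ((- 1) ^ card T * ?p d T)) =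
        of_int (moebius_mu d) * ribbon_sum (n div d) {t. d * t \<in> S}"
      by (simp only: sum_distrib_left[symmetric])
  qed simp
  finally show ?thesis .
qed

section \<open>Euler numbers\<close>

abbreviation fps_sec :: "real fps" where "fps_sec \<equiv> inverse (fps_cos 1)"

lemma fps_sec_cos: "fps_sec * fps_cos 1 = 1"
  by (rule inverse_mult_eq_1) simp

lemma fps_tan_eq_sec_sin: "fps_tan 1 = fps_sec * fps_sin 1"
  by (simp add: fps_tan_def fps_divide_unit mult.commute)

lemma fps_tan_cos: "fps_tan 1 * fps_cos 1 = (fps_sin 1 :: real fps)"
proof -
  have "fps_tan 1 * fps_cos 1 = (fps_sec * fps_cos 1) * fps_sin 1"
    unfolding fps_tan_eq_sec_sin by (simp only: ac_simps)
  then show ?thesis by (simp only: fps_sec_cos mult_1_left)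
qed

text \<open>Multiply the secant by \<open>cos^2 + sin^2 = 1\<close>. The identity is used to
  evaluate the product of tangent and sine.\<close>

lemma fps_sec_eq: "fps_sec = fps_cos 1 + fps_tan 1 * fps_sin 1"
proof -
  have "fps_sec = fps_sec * ((fps_cos 1)\<^sup>2 + (fps_sin 1)\<^sup>2)"
    by (simp add: fps_sin_cos_sum_of_squares)
  also have "\<dots> = (fps_sec * fps_cos 1) * fps_cos 1 + (fps_sec * fps_sin 1) * fps_sin 1"
    by (simp only: power2_eq_square distrib_left mult.assoc)
  finally show ?thesis by (simp only: fps_sec_cos fps_tan_eq_sec_sin mult_1_left)
qed

text \<open>In an odd coefficient of \<open>sec * cos = 1\<close> every term except the last
  vanishes: odd \<open>i < n\<close> by induction, even \<open>i\<close> because the cosine has no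
  odd coefficients.\<close>

lemma fps_sec_odd: "odd n \<Longrightarrow> fps_sec $ n = 0"
proof (induction n rule: less_induct)
  case (less n)
  have "0 = (fps_sec * fps_cos 1) $ n" using less.prems by (cases n) (simp_all add: fps_sec_cos)
  also have "\<dots> = (\<Sum>i=0..n. fps_sec $ i * fps_cos 1 $ (n - i))" by (rule fps_mult_nth)
  also have "\<dots> = (\<Sum>i\<in>{n}. fps_sec $ i * fps_cos 1 $ (n - i))"
  proof (rule sum.mono_neutral_right)
    show "\<forall>i\<in>{0..n} - {n}. fps_sec $ i * fps_cos 1 $ (n - i) = 0"
    proof
      fix i assume i: "i \<in> {0..n} - {n}"
      show "fps_sec $ i * fps_cos 1 $ (n - i) = 0"
      proof (cases "odd i")
        case True
        then show ?thesis using less.IH[of i] i by simp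
      next
        case False
        then have "odd (n - i)" using less.prems i by simp
        then show ?thesis by (simp add: fps_cos_def)
      qed
    qed
  qed auto
  finally show ?case by simp
qed

lemma fps_tan_even: "even n \<Longrightarrow> fps_tan (1 :: real) $ n = 0"
  unfolding fps_tan_eq_sec_sin fps_mult_nth
proof (rule sum.neutral, rule)
  fix i assume "even n" "i \<in> {0..n}"
  then show "fps_sec $ i * fps_sin 1 $ (n - i) = 0"
    by (cases "odd i") (simp_all add: fps_sec_odd fps_sin_def)
qed

lemma euler_num_even: "even n \<Longrightarrow> euler_num n = fact n * fps_sec $ n"
  by (simp add: euler_num_def fps_tan_even)

lemma euler_num_odd: "odd n \<Longrightarrow> euler_num n = fact n * fps_tan 1 $ n"
  by (simp add: euler_num_def fps_sec_odd)

lemma euler_num_0: "euler_num 0 = 1"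
  by (simp add: euler_num_even)

section \<open>Binomial recurrences for Euler numbers\<close>

lemma fact_mult_fps_nth:
  fixes f :: "real fps"
  assumes "t \<le> n"
  shows "fact n * (f $ t * (c / fact (n - t))) = real (n choose t) * c * (fact t * f $ t)"
  using binomial_fact[OF assms, where 'a = real] by simp

lemma minus_one_power_diff: "j \<le> m \<Longrightarrow> (- 1 :: real) ^ m * (- 1) ^ (m - j) = (- 1) ^ j"
  by (metis (no_types) le_add_diff_inverse2 left_minus_one_mult_self power_add mult.commute)

text \<open>Up to the sign \<open>(- 1) ^ (n div 2)\<close>, the sum is \<open>n!\<close> times a
  coefficient of \<open>tan * cos = sin\<close> for odd \<open>n\<close>, and of
  \<open>- tan * sin = cos - sec\<close> for even \<open>n\<close>.\<close>

lemma sum_odd_euler_num: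
  "(\<Sum>t | t \<le> n \<and> odd t. real (n choose t) * ((- 1) ^ (t div 2) * euler_num t)) =
    1 - (if even n then (- 1) ^ (n div 2) * euler_num n else 0)"
proof -
  \<comment> \<open>For \<open>n = 2 * m\<close> and \<open>t = 2 * j + 1\<close> the sine
    coefficient at \<open>n - t\<close> has sign \<open>(- 1) ^ (m - Suc j)\<close>; negating the
    sine makes the exponent \<open>m - j\<close>, as in the odd case.\<close>
  let ?g = "if even n then - fps_sin 1 else fps_cos 1 :: real fps"
  have "(- 1) ^ (n div 2) * (fact n * (fps_tan 1 * ?g) $ n) =
      (\<Sum>t=0..n. (- 1) ^ (n div 2) * (fact n * (fps_tan 1 $ t * ?g $ (n - t))))"
    by (simp add: fps_mult_nth sum_distrib_left)
  also have "\<dots> = (\<Sum>t | t \<le> n \<and> odd t. real (n choose t) * ((- 1) ^ (t div 2) * euler_num t))"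
  proof (rule sum.mono_neutral_cong_right)
    fix t assume "t \<in> {t. t \<le> n \<and> odd t}"
    then have t: "t \<le> n" "odd t" by auto
    then obtain j where j: "t = 2 * j + 1" by (elim oddE)
    show "(- 1) ^ (n div 2) * (fact n * (fps_tan 1 $ t * ?g $ (n - t))) =
        real (n choose t) * ((- 1) ^ (t div 2) * euler_num t)"
    proof (cases "even n")
      case True
      then obtain m where m: "n = 2 * m" by (elim evenE)
      have jm: "Suc j \<le> m" using t j m by simp
      have "?g $ (n - t) = (- 1) ^ (m - j) / fact (n - t)"
      proof -
        have "odd (n - t)" using True t by simp
        moreover have "(n - t - 1) div 2 = m - Suc j" using j m by simp
        moreover have "m - j = Suc (m - Suc j)" using jm by simp
        ultimately show ?thesis using True by (simp add: fps_sin_def)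
      qed
      then have "(- 1) ^ (n div 2) * (fact n * (fps_tan 1 $ t * ?g $ (n - t))) =
          (- 1) ^ m * (real (n choose t) * (- 1) ^ (m - j) * euler_num t)"
        using fact_mult_fps_nth[OF t(1)] m t(2) by (simp add: euler_num_odd)
      also have "\<dots> = real (n choose t) * ((- 1) ^ m * (- 1) ^ (m - j)) * euler_num t"
        by (simp only: ac_simps)
      finally show ?thesis using minus_one_power_diff[of j m] jm j by simp
    next
      case False
      then obtain m where m: "n = 2 * m + 1" by (elim oddE)
      have jm: "j \<le> m" using t j m by simp
      have "?g $ (n - t) = (- 1) ^ (m - j) / fact (n - t)"
      proof -
        have "even (n - t)" using False t by simp
        moreover have "(n - t) div 2 = m - j" using j m by simp
        ultimately show ?thesis using False by (simp add: fps_cos_def)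
      qed
      then have "(- 1) ^ (n div 2) * (fact n * (fps_tan 1 $ t * ?g $ (n - t))) =
          (- 1) ^ m * (real (n choose t) * (- 1) ^ (m - j) * euler_num t)"
        using fact_mult_fps_nth[OF t(1)] m t(2) by (simp add: euler_num_odd)
      also have "\<dots> = real (n choose t) * ((- 1) ^ m * (- 1) ^ (m - j)) * euler_num t"
        by (simp only: ac_simps)
      finally show ?thesis using minus_one_power_diff[of j m] jm j by simp
    qed
  qed (auto simp: fps_tan_even)
  also have "(- 1) ^ (n div 2) * (fact n * (fps_tan 1 * ?g) $ n) =
      1 - (if even n then (- 1) ^ (n div 2) * euler_num n else 0)"
  proof (cases "even n")
    case True
    have "(fps_tan 1 * ?g) $ n = fps_cos 1 $ n - fps_sec $ n"
      using True by (subst fps_sec_eq) simp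
    then show ?thesis
      using True by (simp add: euler_num_even fps_cos_def algebra_simps flip: power_add)
  next
    case False
    then have "(fps_tan 1 * ?g) $ n = (- 1) ^ (n div 2) / fact n"
      by (auto simp: fps_tan_cos fps_sin_def elim!: oddE)
    then show ?thesis using False by (simp flip: power_add)
  qed
  finally show ?thesis by (rule sym)
qed

text \<open>The same computation with \<open>sec * cos = 1\<close> for even \<open>n\<close> and
  \<open>sec * sin = tan\<close> for odd \<open>n\<close>; positivity of \<open>n\<close> avoids the
  constant term 1.\<close>

lemma sum_even_euler_num:
  assumes "n > 0"
  shows "(\<Sum>t | t \<le> n \<and> even t. real (n choose t) * ((- 1) ^ (t div 2) * euler_num t)) =
    (if even n then 0 else (- 1) ^ (n div 2) * euler_num n)"
proof -
  let ?g = "if even n then fps_cos 1 else fps_sin 1 :: real fps"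
  have "(- 1) ^ (n div 2) * (fact n * (fps_sec * ?g) $ n) =
      (\<Sum>t=0..n. (- 1) ^ (n div 2) * (fact n * (fps_sec $ t * ?g $ (n - t))))"
    by (simp add: fps_mult_nth sum_distrib_left)
  also have "\<dots> = (\<Sum>t | t \<le> n \<and> even t. real (n choose t) * ((- 1) ^ (t div 2) * euler_num t))"
  proof (rule sum.mono_neutral_cong_right)
    fix t assume "t \<in> {t. t \<le> n \<and> even t}"
    then have t: "t \<le> n" "even t" by auto
    then obtain j where j: "t = 2 * j" by (elim evenE)
    define m where "m = n div 2"
    have jm: "j \<le> m" using t j unfolding m_def by linarith
    have "?g $ (n - t) = (- 1) ^ (m - j) / fact (n - t)"
    proof (cases "even n")
      case True
      moreover have "even (n - t)" using True t by simp
      moreover have "(n - t) div 2 = m - j" using j True by (auto simp: m_def elim!: evenE)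
      ultimately show ?thesis by (simp add: fps_cos_def)
    next
      case False
      moreover have "odd (n - t)" using False t by simp
      moreover have "(n - t - 1) div 2 = m - j" using j False by (auto simp: m_def elim!: oddE)
      ultimately show ?thesis by (simp add: fps_sin_def)
    qed
    then have "(- 1) ^ (n div 2) * (fact n * (fps_sec $ t * ?g $ (n - t))) =
        (- 1) ^ m * (real (n choose t) * (- 1) ^ (m - j) * euler_num t)"
      using fact_mult_fps_nth[OF t(1)] t(2) by (simp add: euler_num_even m_def)
    also have "\<dots> = real (n choose t) * ((- 1) ^ m * (- 1) ^ (m - j)) * euler_num t"
      by (simp only: ac_simps)
    finally show "(- 1) ^ (n div 2) * (fact n * (fps_sec $ t * ?g $ (n - t))) =
        real (n choose t) * ((- 1) ^ (t div 2) * euler_num t)"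
      using minus_one_power_diff[OF jm] j by simp
  qed (auto simp: fps_sec_odd)
  also have "(- 1) ^ (n div 2) * (fact n * (fps_sec * ?g) $ n) =
      (if even n then 0 else (- 1) ^ (n div 2) * euler_num n)"
    using assms by (simp add: fps_sec_cos euler_num_odd fps_tan_eq_sec_sin)
  finally show ?thesis by (rule sym)
qed

text \<open>The odd cuts below an odd \<open>t\<close> are again of the same kind, so the recurrence
  sums signed Euler numbers over odd \<open>t < n\<close>. For even \<open>n\<close> the identity
  for the full sum contains \<open>E_n\<close> on its right-hand side; for odd \<open>n\<close> it
  is the missing term \<open>t = n\<close>.\<close>

lemma ribbon_sum_odd:
  "n > 0 \<Longrightarrow> ribbon_sum n {t \<in> {1..<n}. odd t} = (- 1) ^ (n div 2) * euler_num n"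
proof (induction n rule: less_induct)
  case (less n)
  let ?S = "{t \<in> {1..<n}. odd t}"
  let ?f = "\<lambda>t. real (n choose t) * ((- 1) ^ (t div 2) * euler_num t)"
  have "ribbon_sum n ?S = 1 - (\<Sum>t\<in>?S. real (n choose t) * ribbon_sum t {s \<in> ?S. s < t})"
    by (rule ribbon_sum_rec) auto
  also have "(\<Sum>t\<in>?S. real (n choose t) * ribbon_sum t {s \<in> ?S. s < t}) = (\<Sum>t\<in>?S. ?f t)"
  proof (rule sum.cong)
    fix t assume t: "t \<in> ?S"
    then have "{s \<in> ?S. s < t} = {s \<in> {1..<t}. odd s}" by auto
    then show "real (n choose t) * ribbon_sum t {s \<in> ?S. s < t} = ?f t"
      using less.IH[of t] t by auto
  qed simp
  also have "1 - (\<Sum>t\<in>?S. ?f t) = (- 1) ^ (n div 2) * euler_num n"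
  proof (cases "even n")
    case True
    then have "{t. t \<le> n \<and> odd t} = ?S" by (auto simp: le_less[of _ n] Suc_le_eq intro: odd_pos)
    then show ?thesis using sum_odd_euler_num[of n] True by simp
  next
    case False
    then have "{t. t \<le> n \<and> odd t} = insert n ?S" by (auto simp: le_less[of _ n] Suc_le_eq intro: odd_pos)
    then show ?thesis using sum_odd_euler_num[of n] False by simp
  qed
  finally show ?case .
qed

lemma ribbon_sum_even:
  "n > 0 \<Longrightarrow> ribbon_sum n {t \<in> {1..<n}. even t} = (- 1) ^ ((n - 1) div 2) * euler_num n"
proof (induction n rule: less_induct)
  case (less n)
  let ?S = "{t \<in> {1..<n}. even t}"
  let ?f = "\<lambda>t. real (n choose t) * ((- 1) ^ (t div 2) * euler_num t)"
  have "ribbon_sum n ?S = 1 - (\<Sum>t\<in>?S. real (n choose t) * ribbon_sum t {s \<in> ?S. s < t})"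
    by (rule ribbon_sum_rec) auto
  also have "(\<Sum>t\<in>?S. real (n choose t) * ribbon_sum t {s \<in> ?S. s < t}) = (\<Sum>t\<in>?S. - ?f t)"
  proof (rule sum.cong)
    fix t assume t: "t \<in> ?S"
    then obtain j where j: "t = 2 * Suc j"
      by (metis (no_types, lifting) evenE mem_Collect_eq atLeastLessThan_iff mult_0_right
          not_one_le_zero not0_implies_Suc)
    have "{s \<in> ?S. s < t} = {s \<in> {1..<t}. even s}" using t by auto
    then have "ribbon_sum t {s \<in> ?S. s < t} = (- 1) ^ ((t - 1) div 2) * euler_num t"
      using less.IH[of t] t by auto
    \<comment> \<open>For even positive \<open>t\<close>, \<open>(t - 1) div 2\<close> is one less
      than \<open>t div 2\<close>.\<close>
    also have "(- 1 :: real) ^ ((t - 1) div 2) = - ((- 1) ^ (t div 2))" by (simp add: j)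
    finally show "real (n choose t) * ribbon_sum t {s \<in> ?S. s < t} = - ?f t" by simp
  qed simp
  \<comment> \<open>The 1 of the recurrence is absorbed as the term \<open>t = 0\<close>, since
    \<open>E_0 = 1\<close>.\<close>
  also have "1 - (\<Sum>t\<in>?S. - ?f t) = (\<Sum>t\<in>insert 0 ?S. ?f t)"
    by (simp add: sum_negf euler_num_0)
  also have "\<dots> = (- 1) ^ ((n - 1) div 2) * euler_num n"
  proof (cases "even n")
    case True
    then obtain j where j: "n = 2 * Suc j" using less.prems by (metis evenE mult_0_right not_gr0 not0_implies_Suc)
    have "{t. t \<le> n \<and> even t} = insert n (insert 0 ?S)" using True by (auto simp: le_less[of _ n] Suc_le_eq)
    then have "0 = ?f n + (\<Sum>t\<in>insert 0 ?S. ?f t)"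
      using sum_even_euler_num[OF less.prems] True less.prems by simp
    then show ?thesis by (simp add: j)
  next
    case False
    then have "{t. t \<le> n \<and> even t} = insert 0 ?S" by (auto simp: le_less[of _ n] Suc_le_eq)
    moreover have "(n - 1) div 2 = n div 2" using False by (elim oddE) simp
    ultimately show ?thesis using sum_even_euler_num[OF less.prems] False by simp
  qed
  finally show ?case .
qed

text \<open>Only the decreasing permutation descends everywhere. In the proof, the recurrence
  becomes the vanishing alternating sum of a row of binomial coefficients, with the term
  \<open>t = n\<close> missing.\<close>

lemma ribbon_sum_all: "n > 0 \<Longrightarrow> ribbon_sum n {1..<n} = (- 1) ^ (n - 1)"
proof (induction n rule: less_induct)
  case (less n)
  have "ribbon_sum n {1..<n} = 1 - (\<Sum>t\<in>{1..<n}. real (n choose t) * ribbon_sum t {s \<in> {1..<n}. s < t})"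
    by (rule ribbon_sum_rec) auto
  also have "(\<Sum>t\<in>{1..<n}. real (n choose t) * ribbon_sum t {s \<in> {1..<n}. s < t}) =
      (\<Sum>t\<in>{1..<n}. - ((- 1) ^ t * real (n choose t)))"
  proof (rule sum.cong)
    fix t assume t: "t \<in> {1..<n}"
    then have "{s \<in> {1..<n}. s < t} = {1..<t}" by auto
    moreover obtain j where "t = Suc j" using t by (cases t) auto
    ultimately show "real (n choose t) * ribbon_sum t {s \<in> {1..<n}. s < t} =
        - ((- 1) ^ t * real (n choose t))"
      using less.IH[of t] t by simp
  qed simp
  also have "1 - (\<Sum>t\<in>{1..<n}. - ((- 1) ^ t * real (n choose t))) =
      (\<Sum>t\<in>insert 0 {1..<n}. (- 1) ^ t * real (n choose t))"
    by (simp add: sum_negf)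
  also have "\<dots> = - ((- 1) ^ n)"
  proof -
    have "{..n} = insert n (insert 0 {1..<n})" using less.prems by auto
    then have "0 = (- 1) ^ n + (\<Sum>t\<in>insert 0 {1..<n}. (- 1) ^ t * real (n choose t))"
      using choose_alternating_sum[OF less.prems, where 'a = real] less.prems by simp
    then show ?thesis by linarith
  qed
  also have "\<dots> = (- 1) ^ (n - 1)" using less.prems by (cases n) auto
  finally show ?case .
qed

section \<open>Alternating cycles\<close>

lemma card_odd_below: "card {t \<in> {1..<n}. odd t} = n div 2"
proof -
  have "{t \<in> {1..<n}. odd t} = (\<lambda>j. 2 * j + 1) ` {..<n div 2}"
    by (auto elim!: oddE simp: image_iff)
  then show ?thesis by (simp add: card_image inj_on_def)
qed

lemma card_even_below: "card {t \<in> {1..<n}. even t} = (n - 1) div 2"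
proof -
  have "{t \<in> {1..<n}. even t} = (\<lambda>j. 2 * j) ` {1..(n - 1) div 2}"
    by (auto elim!: evenE simp: image_iff)
  then show ?thesis by (simp add: card_image inj_on_def)
qed

lemma alternating_iff_descents:
  assumes "inj w"
  shows "alternating n w \<longleftrightarrow> descents n w = {t \<in> {1..<n}. odd t}"
    and "reverse_alternating n w \<longleftrightarrow> descents n w = {t \<in> {1..<n}. even t}"
proof -
  have neq: "w i < w (Suc i) \<longleftrightarrow> \<not> w (Suc i) < w i" for i
    using injD[OF assms, of i "Suc i"] by (auto simp: not_less le_less)
  have "alternating n w \<longleftrightarrow> (\<forall>i\<in>{1..<n}. w (Suc i) < w i \<longleftrightarrow> odd i)"
    unfolding alternating_def by (simp only: neq Suc_eq_plus1[symmetric]) meson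
  then show "alternating n w \<longleftrightarrow> descents n w = {t \<in> {1..<n}. odd t}"
    unfolding descents_def by blast
  have "reverse_alternating n w \<longleftrightarrow> (\<forall>i\<in>{1..<n}. w (Suc i) < w i \<longleftrightarrow> even i)"
    unfolding reverse_alternating_def by (simp only: neq Suc_eq_plus1[symmetric]) meson
  then show "reverse_alternating n w \<longleftrightarrow> descents n w = {t \<in> {1..<n}. even t}"
    unfolding descents_def by blast
qed

lemma alt_cycles_eq: "alt_cycles n = card (cycles_with_descents n {t \<in> {1..<n}. odd t})"
proof -
  have "w permutes {1..n} \<and> cyclic_on w {1..n} \<and> alternating n w \<longleftrightarrow>
      w permutes {1..n} \<and> cyclic_on w {1..n} \<and> descents n w = {t \<in> {1..<n}. odd t}" for w
    using alternating_iff_descents(1)[OF permutes_inj, of w "{1..n}" n] by argo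
  then show ?thesis unfolding alt_cycles_def cycles_with_descents_def by presburger
qed

lemma rev_alt_cycles_eq: "rev_alt_cycles n = card (cycles_with_descents n {t \<in> {1..<n}. even t})"
proof -
  have "w permutes {1..n} \<and> cyclic_on w {1..n} \<and> reverse_alternating n w \<longleftrightarrow>
      w permutes {1..n} \<and> cyclic_on w {1..n} \<and> descents n w = {t \<in> {1..<n}. even t}" for w
    using alternating_iff_descents(2)[OF permutes_inj, of w "{1..n}" n] by argo
  then show ?thesis unfolding rev_alt_cycles_def cycles_with_descents_def by presburger
qed

lemma dilate_interval:
  fixes n d :: nat
  assumes "n > 0" "d dvd n"
  shows "{t. d * t \<in> {t \<in> {1..<n}. P t}} = {t \<in> {1..<n div d}. P (d * t)}"
proof -
  obtain e where n: "n = d * e" using assms(2) by blast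
  have "d > 0" "n div d = e" using assms(1) n by auto
  then have "d * t \<in> {1..<n} \<longleftrightarrow> t \<in> {1..<n div d}" for t
    unfolding n by (auto simp: Suc_le_eq)
  then show ?thesis by blast
qed

text \<open>The outer sign counts the \<open>n div 2\<close> odd positions below \<open>n\<close>. A
  product \<open>d * t\<close> is odd iff both factors are, so an even \<open>d\<close> leaves no
  cuts and the ribbon sum is 1.\<close>

lemma alt_cycles_sum:
  assumes "n > 0"
  shows "real n * real (alt_cycles n) = (- 1) ^ (n div 2) * (\<Sum>d | d dvd n. of_int (moebius_mu d) *
    (if odd d then (- 1) ^ (n div d div 2) * euler_num (n div d) else 1))"
proof -
  have "ribbon_sum (n div d) {t. d * t \<in> {t \<in> {1..<n}. odd t}} =
      (if odd d then (- 1) ^ (n div d div 2) * euler_num (n div d) else 1)" if "d dvd n" for d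
  proof -
    have "n div d > 0" using that assms by (simp add: div_greater_zero_iff dvd_imp_le dvd_pos_nat)
    moreover have "{t \<in> {1..<n div d}. odd (d * t)} = (if odd d then {t \<in> {1..<n div d}. odd t} else {})"
      by auto
    ultimately show ?thesis
      unfolding dilate_interval[OF assms that] by (simp only: ribbon_sum_odd ribbon_sum_empty split: if_split) simp
  qed
  then show ?thesis
    unfolding alt_cycles_eq
    by (subst card_cycles_with_descents[OF assms]) (auto simp: card_odd_below[simplified] intro!: sum.cong)
qed

lemma rev_alt_cycles_sum:
  assumes "n > 0"
  shows "real n * real (rev_alt_cycles n) = (- 1) ^ ((n - 1) div 2) * (\<Sum>d | d dvd n. of_int (moebius_mu d) *
    (if odd d then (- 1) ^ ((n div d - 1) div 2) * euler_num (n div d) else (- 1) ^ (n div d - 1)))"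
proof -
  have "ribbon_sum (n div d) {t. d * t \<in> {t \<in> {1..<n}. even t}} =
      (if odd d then (- 1) ^ ((n div d - 1) div 2) * euler_num (n div d) else (- 1) ^ (n div d - 1))"
    if "d dvd n" for d
  proof -
    have "n div d > 0" using that assms by (simp add: div_greater_zero_iff dvd_imp_le dvd_pos_nat)
    moreover have "{t \<in> {1..<n div d}. even (d * t)} = (if odd d then {t \<in> {1..<n div d}. even t} else {1..<n div d})"
      by auto
    ultimately show ?thesis
      unfolding dilate_interval[OF assms that] by (simp only: ribbon_sum_even ribbon_sum_all split: if_split) simp
  qed
  then show ?thesis
    unfolding rev_alt_cycles_eq
    by (subst card_cycles_with_descents[OF assms]) (auto simp: card_even_below[simplified] intro!: sum.cong)
qed

lemma minus_one_power_eq: "even (a + b) = even c \<Longrightarrow> (- 1 :: real) ^ a * (- 1) ^ b = (- 1) ^ c"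
  by (metis power_add neg_one_even_power neg_one_odd_power)

text \<open>All divisors are odd, so only Euler numbers occur. With \<open>d = 2 * a + 1\<close> and
  \<open>n div d = 2 * b + 1\<close>, the two signs have total exponent
  \<open>2 * a * b + a + 2 * b\<close>, which has the parity of \<open>a\<close>.\<close>

lemma odd_cycles:
  assumes "odd n"
  shows "real n * real (alt_cycles n) =
      (\<Sum>d | d dvd n. of_int (moebius_mu d) * (- 1) ^ ((d - 1) div 2) * euler_num (n div d))"
    and "alt_cycles n = rev_alt_cycles n"
proof -
  have n: "n > 0" using assms by (rule odd_pos)
  have odd: "odd d" "odd (n div d)" if "d dvd n" for d
  proof -
    have "d * (n div d) = n" using that by simp
    then show "odd d" "odd (n div d)" using assms by (metis even_mult_iff)+
  qed
  have sign: "(- 1 :: real) ^ (n div 2) * (- 1) ^ (n div d div 2) = (- 1) ^ ((d - 1) div 2)" if dn: "d dvd n" for d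
  proof (rule minus_one_power_eq)
    obtain a where a: "d = 2 * a + 1" using odd(1)[OF dn] by (elim oddE)
    obtain b where b: "n div d = 2 * b + 1" using odd(2)[OF dn] by (elim oddE)
    have "n = d * (n div d)" using dn by simp
    then have "n = (2 * a + 1) * (2 * b + 1)" using a b by metis
    then have "n div 2 = 2 * a * b + a + b" by (simp add: algebra_simps)
    then show "even (n div 2 + n div d div 2) = even ((d - 1) div 2)" using a b by simp
  qed
  show sum: "real n * real (alt_cycles n) =
      (\<Sum>d | d dvd n. of_int (moebius_mu d) * (- 1) ^ ((d - 1) div 2) * euler_num (n div d))"
    unfolding alt_cycles_sum[OF n] sum_distrib_left
    by (rule sum.cong) (auto simp: odd(1) sign)
  have half: "(m - 1) div 2 = m div 2" if "odd m" for m :: nat using that by (elim oddE) simp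
  have "real n * real (rev_alt_cycles n) =
      (\<Sum>d | d dvd n. of_int (moebius_mu d) * (- 1) ^ ((d - 1) div 2) * euler_num (n div d))"
    unfolding rev_alt_cycles_sum[OF n] sum_distrib_left half[OF assms]
    by (rule sum.cong) (auto simp: odd(1) half[OF odd(2), unfolded One_nat_def] sign)
  with sum have "real n * real (alt_cycles n) = real n * real (rev_alt_cycles n)" by (rule trans[OF _ sym])
  with n show "alt_cycles n = rev_alt_cycles n" by simp
qed

text \<open>The odd divisors of \<open>n\<close> are the divisors of \<open>m\<close>, and there the
  signs cancel and leave the Euler numbers. The even divisors contribute a bare sum of Moebius
  values, up to the sign \<open>(- 1) ^ (n div 2)\<close> in the alternating case.\<close>

lemma even_cycles:
  assumes n: "n = 2 ^ k * m" "k \<ge> 1" "odd m"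
  shows "real n * real (alt_cycles n) =
      (\<Sum>d | d dvd m. of_int (moebius_mu d) * euler_num (n div d)) - (if m = 1 then (- 1) ^ (n div 2) else 0)"
    and "real n * real (rev_alt_cycles n) =
      (\<Sum>d | d dvd m. of_int (moebius_mu d) * euler_num (n div d)) - (if m = 1 then 1 else 0)"
proof -
  have m0: "m > 0" using n(3) by (rule odd_pos)
  then have n0: "n > 0" using n by simp
  have evn: "even n" using n by simp
  define O' where "O' = {d. d dvd n \<and> odd d}"
  define E where "E = {d. d dvd n \<and> even d}"
  have fin: "finite {d. d dvd n}" using n0 by simp
  have finOE: "finite O'" "finite E" unfolding O'_def E_def by (rule finite_subset[OF _ fin]; blast)+
  have split: "sum f {d. d dvd n} = sum f O' + sum f E" for f :: "nat \<Rightarrow> 'a :: comm_monoid_add"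
  proof -
    have "{d. d dvd n} = O' \<union> E" "O' \<inter> E = {}" unfolding O'_def E_def by auto
    then show ?thesis using finOE by (simp add: sum.union_disjoint)
  qed
  have O: "O' = {d. d dvd m}"
  proof -
    have "d dvd n \<longleftrightarrow> d dvd m" if "odd d" for d
      unfolding n(1) using that by (intro coprime_dvd_mult_right_iff) simp
    moreover have "odd d" if "d dvd m" for d using that n(3) by (auto elim!: dvdE)
    ultimately show ?thesis unfolding O'_def by blast
  qed
  have "n \<noteq> 1" using evn by auto
  then have "(\<Sum>d\<in>O'. moebius_mu d) + (\<Sum>d\<in>E. moebius_mu d) = 0"
    using sum_moebius_mu[OF n0] split[of moebius_mu] by simp
  \<comment> \<open>The Moebius values over all divisors of \<open>n\<close> sum to 0, so the even
    divisors contribute the negative of the sum over the divisors of \<open>m\<close>.\<close>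
  then have sumE: "(\<Sum>d\<in>E. moebius_mu d) = - (if m = 1 then 1 else 0)"
    using sum_moebius_mu[OF m0] unfolding O by simp
  have sumE: "(\<Sum>d\<in>E. real_of_int (moebius_mu d)) = - (if m = 1 then 1 else 0)"
    using arg_cong[OF sumE, of real_of_int] by simp
  have factor: "\<exists>a. n = 2 * Suc a * d \<and> n div d = 2 * Suc a" if "d \<in> O'" for d
  proof -
    have d: "d dvd n" "odd d" using that by (auto simp: O'_def)
    then have nd: "n = n div d * d" by simp
    then have "even (n div d)" using d evn by (metis even_mult_iff)
    then obtain c where c: "n div d = 2 * c" by (elim evenE)
    with nd n0 have "c \<noteq> 0" by (metis less_irrefl mult_0 mult_0_right)
    then show ?thesis using c nd by (metis not0_implies_Suc)
  qed
  have "(- 1) ^ (n div 2) * (\<Sum>d\<in>O'. of_int (moebius_mu d) *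
      (if odd d then (- 1) ^ (n div d div 2) * euler_num (n div d) else 1)) =
      (\<Sum>d\<in>O'. of_int (moebius_mu d) * euler_num (n div d))"
    unfolding sum_distrib_left
  proof (rule sum.cong)
    fix d assume d: "d \<in> O'"
    then obtain a where a: "n = 2 * Suc a * d" "n div d = 2 * Suc a" using factor by blast
    have odd: "odd d" using d by (simp add: O'_def)
    \<comment> \<open>\<open>n div 2\<close> is \<open>n div d div 2\<close> times the odd number
      \<open>d\<close>, so both exponents have the same parity.\<close>
    have "(- 1 :: real) ^ (n div 2) * (- 1) ^ (n div d div 2) = (- 1) ^ 0"
    proof (rule minus_one_power_eq)
      have "n div 2 = Suc a * d" using a(1) by simp
      then show "even (n div 2 + n div d div 2) = even (0 :: nat)" using a(2) odd by simp
    qed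
    then show "(- 1) ^ (n div 2) * (of_int (moebius_mu d) *
      (if odd d then (- 1) ^ (n div d div 2) * euler_num (n div d) else 1)) =
      of_int (moebius_mu d) * euler_num (n div d)" using odd by simp
  qed simp
  moreover have "(\<Sum>d\<in>E. of_int (moebius_mu d) *
      (if odd d then (- 1) ^ (n div d div 2) * euler_num (n div d) else 1)) = (\<Sum>d\<in>E. real_of_int (moebius_mu d))"
    by (rule sum.cong) (auto simp: E_def)
  ultimately show "real n * real (alt_cycles n) =
      (\<Sum>d | d dvd m. of_int (moebius_mu d) * euler_num (n div d)) - (if m = 1 then (- 1) ^ (n div 2) else 0)"
    unfolding alt_cycles_sum[OF n0] split distrib_left sumE O by simp
  have "(- 1) ^ ((n - 1) div 2) * (\<Sum>d\<in>O'. of_int (moebius_mu d) *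
      (if odd d then (- 1) ^ ((n div d - 1) div 2) * euler_num (n div d) else (- 1) ^ (n div d - 1))) =
      (\<Sum>d\<in>O'. of_int (moebius_mu d) * euler_num (n div d))"
    unfolding sum_distrib_left
  proof (rule sum.cong)
    fix d assume d: "d \<in> O'"
    then obtain a where a: "n = 2 * Suc a * d" "n div d = 2 * Suc a" using factor by blast
    have odd: "odd d" using d by (simp add: O'_def)
    then obtain b where b: "d = 2 * b + 1" by (elim oddE)
    have "(- 1 :: real) ^ ((n - 1) div 2) * (- 1) ^ ((n div d - 1) div 2) = (- 1) ^ 0"
    proof (rule minus_one_power_eq)
      have "n = 2 * (2 * Suc a * b + a) + 2" using a(1) b by (simp add: algebra_simps)
      then have "(n - 1) div 2 = 2 * Suc a * b + a" by simp
      then show "even ((n - 1) div 2 + (n div d - 1) div 2) = even (0 :: nat)" using a(2) by simp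
    qed
    then show "(- 1) ^ ((n - 1) div 2) * (of_int (moebius_mu d) *
      (if odd d then (- 1) ^ ((n div d - 1) div 2) * euler_num (n div d) else (- 1) ^ (n div d - 1))) =
      of_int (moebius_mu d) * euler_num (n div d)" using odd by simp
  qed simp
  moreover have "(- 1) ^ ((n - 1) div 2) * (\<Sum>d\<in>E. of_int (moebius_mu d) *
      (if odd d then (- 1) ^ ((n div d - 1) div 2) * euler_num (n div d) else (- 1) ^ (n div d - 1))) =
      (\<Sum>d\<in>E. real_of_int (moebius_mu d))"
    unfolding sum_distrib_left
  proof (rule sum.cong)
    fix d assume d: "d \<in> E"
    then have d: "d dvd n" "even d" by (auto simp: E_def)
    show "(- 1) ^ ((n - 1) div 2) * (of_int (moebius_mu d) *
      (if odd d then (- 1) ^ ((n div d - 1) div 2) * euler_num (n div d) else (- 1) ^ (n div d - 1))) =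
      real_of_int (moebius_mu d)"
    \<comment> \<open>A divisor divisible by 4 has Moebius value 0. Otherwise \<open>d\<close> is
      twice an odd number, and then \<open>(n - 1) div 2\<close> and \<open>n div d - 1\<close> have
      the same parity.\<close>
    proof (cases "2 * 2 dvd d")
      case True
      then show ?thesis using moebius_mu_square_dvd[OF two_is_prime_nat True] by simp
    next
      case False
      obtain c where c: "d = 2 * c" using d(2) by (elim evenE)
      with False have "odd c" by auto
      then obtain b where b: "c = 2 * b + 1" by (elim oddE)
      obtain e where e: "n = d * e" using d(1) by blast
      then obtain a where a: "e = Suc a" using n0 by (cases e) auto
      have nd: "n div d = Suc a" using e a n0 by auto
      have "(- 1 :: real) ^ ((n - 1) div 2) * (- 1) ^ (n div d - 1) = (- 1) ^ 0"
      proof (rule minus_one_power_eq)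
        have "n = 2 * (2 * Suc a * b + a) + 2" using e a b c by (simp add: algebra_simps)
        then have "(n - 1) div 2 = 2 * Suc a * b + a" by simp
        then show "even ((n - 1) div 2 + (n div d - 1)) = even (0 :: nat)" using nd by simp
      qed
      then show ?thesis using d(2) by (simp add: mult.left_commute)
    qed
  qed simp
  ultimately show "real n * real (rev_alt_cycles n) =
      (\<Sum>d | d dvd m. of_int (moebius_mu d) * euler_num (n div d)) - (if m = 1 then 1 else 0)"
    unfolding rev_alt_cycles_sum[OF n0] split distrib_left sumE O by simp
qed

lemma euler_num_2: "euler_num 2 = 1"
proof -
  have "{t. t \<le> 2 \<and> even t} = {0, 2 :: nat}" by (auto simp: le_Suc_eq numeral_2_eq_2)
  then show ?thesis using sum_even_euler_num[of 2] by (simp add: euler_num_0)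
qed

theorem theorem5p3:
  shows "(\<forall>n::nat. n \<ge> 1 \<and> odd n \<longrightarrow>
            alt_cycles n = rev_alt_cycles n \<and>
            real (alt_cycles n) = 1 / real n *
              (\<Sum>d | d dvd n. of_int (moebius_mu d) * (- 1) ^ ((d - 1) div 2) * euler_num (n div d)))
       \<and> (\<forall>n k m :: nat. n = 2 ^ k * m \<and> k \<ge> 1 \<and> odd m \<and> m \<ge> 3 \<longrightarrow>
            alt_cycles n = rev_alt_cycles n \<and>
            real (alt_cycles n) = 1 / real n *
              (\<Sum>d | d dvd m. of_int (moebius_mu d) * euler_num (n div d)))
       \<and> (\<forall>n k :: nat. n = 2 ^ k \<and> k \<ge> 2 \<longrightarrow>
            alt_cycles n = rev_alt_cycles n \<and>
            real (alt_cycles n) = 1 / real n * (euler_num n - 1))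
       \<and> alt_cycles 2 = 1 \<and> rev_alt_cycles 2 = 0"
proof -
  have quot: "real a = 1 / real n * s" if "real n * real a = s" "n > 0" for a n s
    using that by (simp add: field_simps)
  have eq: "a = b" if "real n * real a = s" "real n * real b = s" "n > 0" for a b n s
  proof -
    have "real n * real a = real n * real b" using that(1,2) by (rule trans[OF _ sym])
    then show ?thesis using that(3) by simp
  qed
  have mu1: "(\<Sum>d | d dvd (1 :: nat). of_int (moebius_mu d) * euler_num (n div d)) = euler_num n" for n
    by (simp add: moebius_mu_def)
  have 1: "alt_cycles n = rev_alt_cycles n \<and> real (alt_cycles n) = 1 / real n *
      (\<Sum>d | d dvd n. of_int (moebius_mu d) * (- 1) ^ ((d - 1) div 2) * euler_num (n div d))"
    if "odd n" for n
    using odd_cycles[OF that] quot odd_pos[OF that] by blast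
  have 2: "alt_cycles n = rev_alt_cycles n \<and> real (alt_cycles n) = 1 / real n *
      (\<Sum>d | d dvd m. of_int (moebius_mu d) * euler_num (n div d))"
    if n: "n = 2 ^ k * m" "k \<ge> 1" "odd m" "m \<ge> 3" for n k m
  proof -
    have n0: "n > 0" and m: "m \<noteq> 1" using n by auto
    note cyc = even_cycles[OF n(1-3), unfolded if_not_P[OF m] diff_0_right]
    show ?thesis using eq[OF cyc n0] quot[OF cyc(1) n0] ..
  qed
  have 3: "alt_cycles n = rev_alt_cycles n \<and> real (alt_cycles n) = 1 / real n * (euler_num n - 1)"
    if n: "n = 2 ^ k" "k \<ge> 2" for n k
  proof -
    obtain j where j: "k = Suc (Suc j)" using n(2) by (metis Suc_le_D numeral_2_eq_2 Suc_le_mono)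
    \<comment> \<open>The exponent is at least 2, so \<open>n div 2\<close> is even and the
      corrections for both kinds of cycles equal 1.\<close>
    have n0: "n > 0" and half: "even (n div 2)" using n j by auto
    have cyc: "real n * real (alt_cycles n) = euler_num n - 1"
      "real n * real (rev_alt_cycles n) = euler_num n - 1"
      using even_cycles[of n k 1] n half unfolding mu1 by auto
    show ?thesis using eq[OF cyc n0] quot[OF cyc(1) n0] ..
  qed
  \<comment> \<open>Here \<open>n div 2 = 1\<close> is odd, so the corrections differ in sign: twice
    the counts are \<open>E_2 + 1 = 2\<close> and \<open>E_2 - 1 = 0\<close>.\<close>
  have "alt_cycles 2 = 1" "rev_alt_cycles 2 = 0"
    using even_cycles[of 2 1 1] unfolding mu1 by (simp_all add: euler_num_2)
  with 1 2 3 show ?thesis by blast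
qed

end
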